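(* Let $\mathcal{R}$ be a finite TRS such that there exists a proof tree $\mathcal{T}$ of $\mathcal{R}$ in which every edge label is a reduction pair processor, a dependency graph processor, or a subterm criterion processor (so $\mathcal{R}$ is terminating). Suppose that some reduction pair function $g$ of $\mathcal{R}$ with respect to $\mathcal{T}$ is multiply recursive. Then the derivational complexity function $\mathrm{dc}_{\mathcal{R}}$ is bounded from above by a multiply recursive function. Furthermore, this upper bound is tight: for every multiply recursive function $f$ there exists a finite TRS $\mathcal{R}'$ admitting such a proof tree with a multiply recursive reduction pair function, and such that $\mathrm{dc}_{\mathcal{R}'}$ majorises $f$.
   Context: Terms are built over a finite signature $\mathcal{F}$ (containing at least one constant) and a countably infinite set of variables; a (finite) TRS $\mathcal{R}$ is a finite set of rewrite rules $l\to r$ ($l$ not a variable, variables of $r$ occur in $l$); defined symbols are root symbols of left-hand sides. $\to_{\mathcal{R}}$ is the rewrite relation, $\unrhd$ ($\rhd$) the (proper) superterm relation, $|t|$ the size (number of symbols) of $t$. For rule sets $\mathcal{P},\mathcal{S}$, the relative rewrite relation is $\to_{\mathcal{P}/\mathcal{S}}={\to_{\mathcal{S}}^*}\cdot{\to_{\mathcal{P}}}\cdot{\to_{\mathcal{S}}^*}$, and $\mathrm{NF}(\mathcal{P}/\mathcal{S})$ its normal forms. For a finitely branching well-founded relation $\to$, $\mathrm{dh}(s,\to)=\max\{n\mid \exists t\, s\to^n t\}$; $\mathrm{dc}_{\mathcal{R}}(n)=\max\{\mathrm{dh}(t,\to_{\mathcal{R}})\mid |t|\le n\}$. Dependency pairs: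 for each defined $f$ of arity $n$ take a fresh $n$-ary symbol $f^\sharp$; $t^\sharp=t$ for a variable $t$ and $t^\sharp=f^\sharp(t_1,\dots,t_n)$ for $t=f(t_1,\dots,t_n)$. $\mathrm{DP}(\mathcal{R})=\{l^\sharp\to u^\sharp\mid l\to r\in\mathcal{R},\ u\unlhd r,\ u\not\lhd l,\ \text{root of } u \text{ defined}\}$. A DP problem is a pair $(\mathcal{P},\mathcal{R})$ with $\mathcal{P}\subseteq\mathrm{DP}(\mathcal{R})$. DP processors map DP problems to sets of DP problems: (RP) Given a reduction pair $(\succcurlyeq,\succ)$ ($\succcurlyeq$ a preorder closed under contexts and substitutions, $\succ$ a well-founded order closed under substitutions, ${\succcurlyeq}\cdot{\succ}\cdot{\succcurlyeq}\subseteq{\succ}$): $\Phi((\mathcal{P},\mathcal{R}))=\{(\mathcal{P}',\mathcal{R})\}$ if $\mathcal{P}'\cup\mathcal{R}\subseteq{\succcurlyeq}$ and $\mathcal{P}\setminus\mathcal{P}'\subseteq{\succ}$, and $\{(\mathcal{P},\mathcal{R})\}$ otherwise. (DG) The dependency graph $\mathrm{DG}(\mathcal{P},\mathcal{R})$ has nodes $\mathcal{P}$ and an edge from $s\to t$ to $u\to v$ iff $t\sigma\to_{\mathcal{R}}^* u\tau$ for some substitutions $\sigma,\tau$. An SCC is a maximal set of nodes such that any two are connected by a path; it is trivial if it is a single node whose only path to itself is the empty path, nontrivial otherwise. $\Phi((\mathcal{P},\mathcal{R}))=\{(\mathcal{P}',\mathcal{R})\mid \mathcal{P}' \text{ a nontrivial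 SCC of } \mathrm{DG}(\mathcal{P},\mathcal{R})\}$. (SC) A simple projection $\pi$ assigns to each $f^\sharp$ of arity $n$ an index $1\le\pi(f^\sharp)\le n$, with $\pi(f^\sharp(t_1,\dots,t_n))=t_{\pi(f^\sharp)}$. $\Phi((\mathcal{P},\mathcal{R}))=\{(\mathcal{P}',\mathcal{R})\}$ if $\pi(s)\unrhd\pi(t)$ for all $s\to t\in\mathcal{P}'$ and $\pi(s)\rhd\pi(t)$ for all $s\to t\in\mathcal{P}\setminus\mathcal{P}'$, and $\{(\mathcal{P},\mathcal{R})\}$ otherwise. A proof tree of $\mathcal{R}$ is a tree whose nodes are DP problems, whose root is $(\mathrm{DP}(\mathcal{R}),\mathcal{R})$, whose leaves are of the form $(\varnothing,\mathcal{R})$, and such that for each inner node $(\mathcal{P},\mathcal{R})$ there is a processor $\Phi$ such that every element of $\Phi((\mathcal{P},\mathcal{R}))$ is a child of it, the edges being labelled by $\Phi$. Reduction pair function: let $k$ be the maximum number of SCCs (trivial and nontrivial) in any dependency graph used by a DG-processor in $\mathcal{T}$. A monotone $g:\mathbb{N}\to\mathbb{N}$ is a reduction pair function of $\mathcal{R}$ w.r.t. $\mathcal{T}$ if for all $n$, $g(n)\ge k$ and $g(n)\ge \mathrm{dh}(t^\sharp,\to_{(\mathcal{P}\setminus\mathcal{Q})/(\mathcal{R}\cup\mathcal{Q})})$ for every edge of $\mathcal{T}$ from $(\mathcal{P},\mathcal{R})$ to $(\mathcal{Q},\mathcal{R})$ labelled by a reduction pair processor and every term $t$ with $|t|\le n$.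 Multiply recursive functions: the smallest class of functions over $\mathbb{N}$ containing the zero functions, successor, projections and all $k$-ary Ackermann functions $A_k$ ($k\ge2$), closed under composition and primitive recursion, where $A_k(0,\dots,0,x_k)=x_k+1$, $A_k(x_1,\dots,x_{k-2},x_{k-1}+1,0)=A_k(x_1,\dots,x_{k-1},1)$, $A_k(x_1,\dots,x_{k-2},x_{k-1}+1,x_k+1)=A_k(x_1,\dots,x_{k-1},A_k(x_1,\dots,x_{k-2},x_{k-1}+1,x_k))$, $A_k(x_1,\dots,x_{i-1},x_i+1,0,\dots,0,x_k)=A_k(x_1,\dots,x_i,x_k,0,\dots,0,x_k)$. *)

theory Defs
  imports Main "HOL-Library.Extended_Nat"
begin

text \<open>A function symbol is a pair of a name and an arity, and a signature is a set of such pairs.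
  The raw type of terms does not enforce arities; \<open>terms F\<close> is the set of terms over \<open>F\<close>.\<close>

datatype 'f trm = Var nat | Fun 'f "'f trm list"

type_synonym 'f rule = "'f trm \<times> 'f trm"

definition signature :: "('f \<times> nat) set \<Rightarrow> bool" where
  "signature F \<longleftrightarrow> finite F \<and> (\<exists>c. (c, 0) \<in> F)"

inductive_set "terms" :: "('f \<times> nat) set \<Rightarrow> 'f trm set" for F where
  Var: "Var x \<in> terms F"
| Fun: "(f, length ts) \<in> F \<Longrightarrow> (\<And>t. t \<in> set ts \<Longrightarrow> t \<in> terms F) \<Longrightarrow> Fun f ts \<in> terms F"

fun vars :: "'f trm \<Rightarrow> nat set" where
  "vars (Var x) = {x}"
| "vars (Fun f ts) = (\<Union>t\<in>set ts. vars t)"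

fun tsize :: "'f trm \<Rightarrow> nat" where
  "tsize (Var x) = 1"
| "tsize (Fun f ts) = Suc (\<Sum>t\<leftarrow>ts. tsize t)"

fun subst :: "'f trm \<Rightarrow> (nat \<Rightarrow> 'f trm) \<Rightarrow> 'f trm" where
  "subst (Var x) \<sigma> = \<sigma> x"
| "subst (Fun f ts) \<sigma> = Fun f (map (\<lambda>t. subst t \<sigma>) ts)"

fun subterms :: "'f trm \<Rightarrow> 'f trm set" where
  "subterms (Var x) = {Var x}"
| "subterms (Fun f ts) = insert (Fun f ts) (\<Union>t\<in>set ts. subterms t)"

definition supteq :: "'f trm \<Rightarrow> 'f trm \<Rightarrow> bool" where
  "supteq s t \<longleftrightarrow> t \<in> subterms s"

definition supt :: "'f trm \<Rightarrow> 'f trm \<Rightarrow> bool" where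
  "supt s t \<longleftrightarrow> supteq s t \<and> s \<noteq> t"

definition trs :: "('f \<times> nat) set \<Rightarrow> 'f rule set \<Rightarrow> bool" where
  "trs F R \<longleftrightarrow> (\<forall>(l, r)\<in>R. l \<in> terms F \<and> r \<in> terms F \<and> (\<forall>x. l \<noteq> Var x) \<and> vars r \<subseteq> vars l)"

definition defined_syms :: "'f rule set \<Rightarrow> ('f \<times> nat) set" where
  "defined_syms R = {(f, length ts) | f ts r. (Fun f ts, r) \<in> R}"

inductive_set rstep :: "'f rule set \<Rightarrow> 'f trm rel" for R where
  root: "(l, r) \<in> R \<Longrightarrow> (subst l \<sigma>, subst r \<sigma>) \<in> rstep R"
| arg: "(s, t) \<in> rstep R \<Longrightarrow> (Fun f (ss @ s # us), Fun f (ss @ t # us)) \<in> rstep R"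

definition rel_rstep :: "'f rule set \<Rightarrow> 'f rule set \<Rightarrow> 'f trm rel" where
  "rel_rstep P S = (rstep S)\<^sup>* O rstep P O (rstep S)\<^sup>*"

text \<open>The supremum in \<open>enat\<close> is the maximum whenever the latter exists, and \<open>\<infinity>\<close> if there
  are arbitrarily long derivations.\<close>

definition dh :: "'a \<Rightarrow> 'a rel \<Rightarrow> enat" where
  "dh s r = (SUP n\<in>{n. \<exists>t. (s, t) \<in> r ^^ n}. enat n)"

definition dc :: "('f \<times> nat) set \<Rightarrow> 'f rule set \<Rightarrow> nat \<Rightarrow> enat" where
  "dc F R n = (SUP t\<in>{t \<in> terms F. tsize t \<le> n}. dh t (rstep R))"

datatype 'f dpsym = Plain 'f | Sharp 'f

type_synonym 'f dprule = "'f dpsym rule"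
type_synonym 'f dp_problem = "'f dprule set \<times> 'f rule set"

abbreviation plain :: "'f trm \<Rightarrow> 'f dpsym trm" where
  "plain \<equiv> map_trm Plain"

definition plain_rules :: "'f rule set \<Rightarrow> 'f dprule set" where
  "plain_rules R = map_prod plain plain ` R"

fun sharp :: "'f trm \<Rightarrow> 'f dpsym trm" where
  "sharp (Var x) = Var x"
| "sharp (Fun f ts) = Fun (Sharp f) (map plain ts)"

definition sharp_sig :: "('f \<times> nat) set \<Rightarrow> 'f rule set \<Rightarrow> ('f dpsym \<times> nat) set" where
  "sharp_sig F R = {(Plain f, n) | f n. (f, n) \<in> F} \<union> {(Sharp f, n) | f n. (f, n) \<in> defined_syms R}"

definition DP :: "'f rule set \<Rightarrow> 'f dprule set" where
  "DP R = {(sharp l, sharp u) | l r u. (l, r) \<in> R \<and> supteq r u \<and> \<not> supt l u \<and>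
     (\<exists>f ts. u = Fun f ts \<and> (f, length ts) \<in> defined_syms R)}"

definition dp_problem :: "'f rule set \<Rightarrow> 'f dp_problem \<Rightarrow> bool" where
  "dp_problem R p \<longleftrightarrow> fst p \<subseteq> DP R \<and> snd p = R"

text \<open>Both relations of a reduction pair live on the terms over the signature \<open>G\<close>.\<close>

definition reduction_pair :: "('g \<times> nat) set \<Rightarrow> 'g trm rel \<Rightarrow> 'g trm rel \<Rightarrow> bool" where
  "reduction_pair G geq gr \<longleftrightarrow>
     geq \<subseteq> terms G \<times> terms G \<and> (\<forall>t\<in>terms G. (t, t) \<in> geq) \<and> trans geq \<and>
     (\<forall>s t f ss us. (s, t) \<in> geq \<longrightarrow> Fun f (ss @ s # us) \<in> terms G \<longrightarrow>
        (Fun f (ss @ s # us), Fun f (ss @ t # us)) \<in> geq) \<and>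
     (\<forall>s t \<sigma>. (s, t) \<in> geq \<longrightarrow> range \<sigma> \<subseteq> terms G \<longrightarrow> (subst s \<sigma>, subst t \<sigma>) \<in> geq) \<and>
     gr \<subseteq> terms G \<times> terms G \<and> trans gr \<and> wf (gr\<inverse>) \<and>
     (\<forall>s t \<sigma>. (s, t) \<in> gr \<longrightarrow> range \<sigma> \<subseteq> terms G \<longrightarrow> (subst s \<sigma>, subst t \<sigma>) \<in> gr) \<and>
     geq O gr O geq \<subseteq> gr"

definition dg_edges :: "('f \<times> nat) set \<Rightarrow> 'f dprule set \<Rightarrow> 'f rule set \<Rightarrow> 'f dprule rel" where
  "dg_edges F P R = {((s, t), (u, v)) | s t u v. (s, t) \<in> P \<and> (u, v) \<in> P \<and>
     (\<exists>\<sigma> \<tau>. range \<sigma> \<subseteq> terms (sharp_sig F R) \<and> range \<tau> \<subseteq> terms (sharp_sig F R) \<and>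
        (subst t \<sigma>, subst u \<tau>) \<in> (rstep (plain_rules R))\<^sup>*)}"

definition connected_nodes :: "'a rel \<Rightarrow> 'a set \<Rightarrow> bool" where
  "connected_nodes E C \<longleftrightarrow> (\<forall>p\<in>C. \<forall>q\<in>C. (p, q) \<in> E\<^sup>*)"

definition sccs :: "'a set \<Rightarrow> 'a rel \<Rightarrow> 'a set set" where
  "sccs N E = {C. C \<noteq> {} \<and> C \<subseteq> N \<and> connected_nodes E C \<and>
     (\<forall>D. C \<subset> D \<and> D \<subseteq> N \<longrightarrow> \<not> connected_nodes E D)}"

definition trivial_scc :: "'a rel \<Rightarrow> 'a set \<Rightarrow> bool" where
  "trivial_scc E C \<longleftrightarrow> (\<exists>p. C = {p} \<and> (p, p) \<notin> E\<^sup>+)"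

text \<open>Argument positions are counted from 1. A simple projection is only required to be
  meaningful on the symbols that it is applied to; in particular, none exists for a set of pairs
  in which a nullary sharp symbol occurs.\<close>

fun proj :: "('f \<times> nat \<Rightarrow> nat) \<Rightarrow> 'f dpsym trm \<Rightarrow> 'f dpsym trm" where
  "proj \<pi> (Fun (Sharp f) ts) = ts ! (\<pi> (f, length ts) - 1)"
| "proj \<pi> t = t"

definition simple_projection :: "('f \<times> nat \<Rightarrow> nat) \<Rightarrow> 'f dprule set \<Rightarrow> bool" where
  "simple_projection \<pi> P \<longleftrightarrow> (\<forall>(s, t)\<in>P. \<forall>u\<in>{s, t}. \<exists>f ts. u = Fun (Sharp f) ts \<and>
     1 \<le> \<pi> (f, length ts) \<and> \<pi> (f, length ts) \<le> length ts)"

datatype 'f processor =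
  Reduction_Pair "'f dpsym trm rel" "'f dpsym trm rel" "'f dprule set"
| Dependency_Graph
| Subterm_Criterion "'f \<times> nat \<Rightarrow> nat" "'f dprule set"

fun valid_processor :: "('f \<times> nat) set \<Rightarrow> 'f rule set \<Rightarrow> 'f processor \<Rightarrow> bool" where
  "valid_processor F R (Reduction_Pair geq gr P') = reduction_pair (sharp_sig F R) geq gr"
| "valid_processor F R Dependency_Graph = True"
| "valid_processor F R (Subterm_Criterion \<pi> P') = True"

fun apply_processor ::
  "('f \<times> nat) set \<Rightarrow> 'f processor \<Rightarrow> 'f dp_problem \<Rightarrow> 'f dp_problem set" where
  "apply_processor F (Reduction_Pair geq gr P') (P, R) =
     (if P' \<union> plain_rules R \<subseteq> geq \<and> P - P' \<subseteq> gr then {(P', R)} else {(P, R)})"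
| "apply_processor F Dependency_Graph (P, R) =
     {(P', R) | P'. P' \<in> sccs P (dg_edges F P R) \<and> \<not> trivial_scc (dg_edges F P R) P'}"
| "apply_processor F (Subterm_Criterion \<pi> P') (P, R) =
     (if simple_projection \<pi> (P \<union> P') \<and>
         (\<forall>(s, t)\<in>P'. supteq (proj \<pi> s) (proj \<pi> t)) \<and>
         (\<forall>(s, t)\<in>P - P'. supt (proj \<pi> s) (proj \<pi> t))
      then {(P', R)} else {(P, R)})"

text \<open>All edges leaving an inner node carry the same label, so the processor is stored at the node.
  Every element of the result of the processor has to be a child, but other children are allowed:
  an inner node with an empty result still needs some child, for instance a leaf.\<close>

datatype 'f proof_tree =
  Leaf "'f dp_problem"
| Inner "'f dp_problem" "'f processor" "'f proof_tree list"

fun tree_root :: "'f proof_tree \<Rightarrow> 'f dp_problem" where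
  "tree_root (Leaf p) = p"
| "tree_root (Inner p \<Phi> ts) = p"

fun wf_tree :: "('f \<times> nat) set \<Rightarrow> 'f rule set \<Rightarrow> 'f proof_tree \<Rightarrow> bool" where
  "wf_tree F R (Leaf p) \<longleftrightarrow> p = ({}, R)"
| "wf_tree F R (Inner p \<Phi> ts) \<longleftrightarrow> dp_problem R p \<and> valid_processor F R \<Phi> \<and> ts \<noteq> [] \<and>
     apply_processor F \<Phi> p \<subseteq> tree_root ` set ts \<and> (\<forall>t\<in>set ts. wf_tree F R t)"

definition proof_tree :: "('f \<times> nat) set \<Rightarrow> 'f rule set \<Rightarrow> 'f proof_tree \<Rightarrow> bool" where
  "proof_tree F R T \<longleftrightarrow> tree_root T = (DP R, R) \<and> wf_tree F R T"

fun edges :: "'f proof_tree \<Rightarrow> ('f dp_problem \<times> 'f processor \<times> 'f dp_problem) set" where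
  "edges (Leaf p) = {}"
| "edges (Inner p \<Phi> ts) = (\<lambda>t. (p, \<Phi>, tree_root t)) ` set ts \<union> (\<Union>t\<in>set ts. edges t)"

definition max_sccs :: "('f \<times> nat) set \<Rightarrow> 'f proof_tree \<Rightarrow> nat" where
  "max_sccs F T = Max (insert 0
     {card (sccs P (dg_edges F P R)) | P R q. ((P, R), Dependency_Graph, q) \<in> edges T})"

definition reduction_pair_function ::
  "('f \<times> nat) set \<Rightarrow> 'f rule set \<Rightarrow> 'f proof_tree \<Rightarrow> (nat \<Rightarrow> nat) \<Rightarrow> bool" where
  "reduction_pair_function F R T g \<longleftrightarrow> mono g \<and> (\<forall>n. max_sccs F T \<le> g n \<and>
     (\<forall>P geq gr P' Q t. ((P, R), Reduction_Pair geq gr P', (Q, R)) \<in> edges T \<longrightarrow>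
        t \<in> terms F \<longrightarrow> tsize t \<le> n \<longrightarrow>
        dh (sharp t) (rel_rstep (P - Q) (plain_rules R \<union> Q)) \<le> enat (g n)))"

lemma replicate_snoc_inj:
  assumes "xs @ Suc x # replicate j 0 = xs' @ Suc x' # replicate j' 0"
  shows "xs = xs' \<and> x = x' \<and> j = j'"
proof -
  have *: "takeWhile ((=) 0) (replicate j 0 @ Suc x # rev xs) = replicate j 0"
    "dropWhile ((=) 0) (replicate j 0 @ Suc x # rev xs) = Suc x # rev xs" for xs x and j :: nat
    by (induction j) auto
  have "replicate j 0 @ Suc x # rev xs = replicate j' 0 @ Suc x' # rev xs'"
    using arg_cong[OF assms, of rev] by simp
  then have "replicate j (0::nat) = replicate j' 0" "Suc x # rev xs = Suc x' # rev xs'"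
    using * by metis+
  then show ?thesis
    by (metis length_replicate list.inject nat.inject rev_rev_ident)
qed

lemma zeros_or_last_nonzero:
  "(\<exists>k. zs = replicate k 0) \<or> (\<exists>xs x j. zs = xs @ Suc x # replicate j (0::nat))"
proof (induction zs rule: rev_induct)
  case (snoc z zs)
  show ?case
  proof (cases z)
    case 0
    from snoc.IH show ?thesis
    proof (elim disjE exE)
      fix k assume "zs = replicate k 0"
      then have "zs @ [z] = replicate (Suc k) 0" using 0 by (simp add: replicate_append_same)
      then show ?thesis by blast
    next
      fix xs x j assume "zs = xs @ Suc x # replicate j 0"
      then have "zs @ [z] = xs @ Suc x # replicate (Suc j) 0"
        using 0 by (simp add: replicate_append_same)
      then show ?thesis by blast
    qed
  next
    case (Suc x)
    then have "zs @ [z] = zs @ Suc x # replicate 0 0" by simp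
    then show ?thesis by blast
  qed
qed simp

lemma replicate_neq_nonzero: "replicate k 0 \<noteq> xs @ Suc x # ys"
proof
  assume "replicate k 0 = xs @ Suc x # ys"
  then have "Suc x \<in> set (replicate k 0)" by simp
  then show False by (simp split: if_splits)
qed

text \<open>The \<open>k\<close>-ary Ackermann function \<open>A\<^sub>k\<close> is \<open>ack\<close> restricted to lists of length
  \<open>k \<ge> 2\<close>; the last equation is a dummy.\<close>

function ack :: "nat list \<Rightarrow> nat" where
  "ack (replicate (Suc k) 0 @ [y]) = Suc y"
| "ack (xs @ [Suc x, 0]) = ack (xs @ [x, 1])"
| "ack (xs @ [Suc x, Suc y]) = ack (xs @ [x, ack (xs @ [Suc x, y])])"
| "ack (xs @ Suc x # replicate (Suc j) 0 @ [y]) = ack (xs @ x # y # replicate j 0 @ [y])"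
| "length xs < 2 \<Longrightarrow> ack xs = 0"
proof goal_cases
  case (1 P zs)
  show ?case
  proof (cases "length zs < 2")
    case False
    then obtain z zs' y where zs: "zs = (z # zs') @ [y]"
      by (cases zs; cases "tl zs" rule: rev_cases) auto
    from zeros_or_last_nonzero[of "z # zs'"] show ?thesis
    proof (elim disjE exE)
      fix k assume "z # zs' = replicate k 0"
      with zs 1(1) show ?thesis by (cases k) auto
    next
      fix xs x j assume *: "z # zs' = xs @ Suc x # replicate j 0"
      show ?thesis
      proof (cases j)
        case 0
        with zs * 1(2)[of xs x] 1(3)[of xs x] show ?thesis by (cases y) auto
      next
        case (Suc i)
        with zs * 1(4)[of xs x i y] show ?thesis by simp
      qed
    qed
  qed (use 1(5) in blast)
qed (auto simp: replicate_neq_nonzero simp del: replicate_Suc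
  dest: replicate_snoc_inj replicate_snoc_inj[where j = 0, simplified])
termination
  by (relation "lex less_than") (auto simp: lex_append_leftI)

text \<open>A function of arity \<open>n\<close> is represented by its values on lists of length \<open>n\<close>; the rule
  \<open>ext\<close> makes the values on other lists irrelevant.\<close>

inductive multiply_recursive :: "nat \<Rightarrow> (nat list \<Rightarrow> nat) \<Rightarrow> bool" where
  zero: "multiply_recursive n (\<lambda>xs. 0)"
| succ: "multiply_recursive 1 (\<lambda>xs. Suc (xs ! 0))"
| proj: "i < n \<Longrightarrow> multiply_recursive n (\<lambda>xs. xs ! i)"
| ack: "2 \<le> k \<Longrightarrow> multiply_recursive k ack"
| comp: "multiply_recursive (length gs) f \<Longrightarrow> (\<And>g. g \<in> set gs \<Longrightarrow> multiply_recursive n g) \<Longrightarrow>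
    multiply_recursive n (\<lambda>xs. f (map (\<lambda>g. g xs) gs))"
| prim_rec: "multiply_recursive n f \<Longrightarrow> multiply_recursive (Suc (Suc n)) g \<Longrightarrow>
    multiply_recursive (Suc n)
      (\<lambda>xs. rec_nat (f (tl xs)) (\<lambda>y r. g (y # r # tl xs)) (hd xs))"
| ext: "multiply_recursive n f \<Longrightarrow> (\<And>xs. length xs = n \<Longrightarrow> f' xs = f xs) \<Longrightarrow>
    multiply_recursive n f'"

definition multiply_recursive_unary :: "(nat \<Rightarrow> nat) \<Rightarrow> bool" where
  "multiply_recursive_unary f \<longleftrightarrow> multiply_recursive 1 (\<lambda>xs. f (xs ! 0))"

text \<open>Argument tuples are compared with \<open>h\<close> through their maximum. The all-zero tuple is
  left out because, with \<open>h = dc F R\<close>, there is no term of size 0, so that \<open>dc F R 0 = 0\<close>.\<close>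

definition majorises :: "(nat \<Rightarrow> enat) \<Rightarrow> nat \<Rightarrow> (nat list \<Rightarrow> nat) \<Rightarrow> bool" where
  "majorises h n f \<longleftrightarrow>
     (\<forall>xs. length xs = n \<longrightarrow> Max (set xs) \<noteq> 0 \<longrightarrow> enat (f xs) \<le> h (Max (set xs)))"

end

theory Submission
  imports Defs
begin

text \<open>Upper bound: call \<open>n\<close> a bound of \<open>t\<close> if \<open>k + |t'| \<le> n\<close> whenever \<open>t\<close> rewrites to \<open>t'\<close> in \<open>k\<close> steps. Each
  node of the proof tree contributes one natural number to a rank of terms with terminating arguments:
  a reduction pair edge the relative derivation height of the marked term, a subterm criterion edge
  the least bound of the projected argument, and a dependency graph node the number of pairs that
  are still reachable; all pair steps that keep the same set of reachable pairs stay within one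
  nontrivial SCC. Ranks have fixed length, decrease lexicographically along dependency pairs, and
  their entries are bounded by a multiply recursive function of the bounds of the arguments. Hence the
  bound of a term is dominated by an Ackermann function indexed by its rank, and iterating
  over the term structure stays below a further Ackermann function.

  Tightness: every multiply recursive function is dominated by some \<open>A\<^sub>k\<close> with all arguments but the
  last fixed. The defining equations of \<open>A\<^sub>k\<close> are terminating by the subterm criterion applied to
  the arguments from left to right, and a counter that consumes the computed numeral makes the
  derivations as long as the value is large.\<close>

subsection \<open>Ackermann functions as a hierarchy\<close>

text \<open>The obstacle is that ranks cannot be fixed before the derivation starts: a right-hand
  side may nest calls, so the arguments of an outer call, and with them the entries of its rank, are
  bounded only through the bounds of the inner calls. Nested recursion along a lexicographic descent
  whose later entries are reset to large values is what the Ackermann equations unfold, and the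
  length of the ranks, which depends on the proof tree alone, fixes the arity. Comparing two indices
  at one argument needs care: a lexicographically smaller index may have larger later entries and
  then give a larger value. The comparison is sound once the argument exceeds these entries, so it
  is raised above them first; an increment of the argument can in turn be traded for an increment of
  the last index entry. Sizes are counted together with steps because a reduction pair function is
  measured in the size of the start term.\<close>

definition ackl :: "nat list \<Rightarrow> nat \<Rightarrow> nat" where
  "ackl a y = ack (a @ [y])"

text \<open>Lexicographic descent of the index alone does not make the value smaller, because the
  entries of \<open>b\<close> behind the first difference may be huge. Exactly these have to lie
  below \<open>z\<close>, the argument at which both branches will be evaluated; the common prefix
  is free.\<close>

definition lexbelow :: "nat \<Rightarrow> nat list \<Rightarrow> nat list \<Rightarrow> bool" where
  "lexbelow z b a \<longleftrightarrow> (\<exists>c x bs x' as. b = c @ x # bs \<and> a = c @ x' # as \<and> x < x' \<and>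
     length bs = length as \<and> (\<forall>v\<in>set bs. v < z))"

lemma lexbelowI:
  "x < x' \<Longrightarrow> length bs = length as \<Longrightarrow> (\<And>v. v \<in> set bs \<Longrightarrow> v < z) \<Longrightarrow>
    lexbelow z (c @ x # bs) (c @ x' # as)"
  unfolding lexbelow_def by blast

lemma ackl_zeros: "a \<noteq> [] \<Longrightarrow> set a \<subseteq> {0} \<Longrightarrow> ackl a y = Suc y"
proof -
  assume "a \<noteq> []" "set a \<subseteq> {0}"
  then have "a = replicate (Suc (length a - 1)) 0"
    by (metis Suc_pred' length_greater_0_conv replicate_eqI singletonD subset_code(1))
  then show ?thesis unfolding ackl_def by (metis ack.simps(1))
qed

lemma ackl_snoc_0: "ackl (a @ [Suc j]) 0 = ackl (a @ [j]) 1"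
  using ack.simps(2)[of a j] by (simp add: ackl_def del: ack.simps)

lemma ackl_snoc_Suc: "ackl (a @ [Suc j]) (Suc y) = ackl (a @ [j]) (ackl (a @ [Suc j]) y)"
  using ack.simps(3)[of a j y] by (simp add: ackl_def del: ack.simps)

lemma ackl_reset:
  "ackl (a @ Suc x # replicate (Suc j) 0) y = ackl (a @ x # y # replicate j 0) y"
  using ack.simps(4)[of a x j y] by (simp add: ackl_def del: ack.simps)

lemma ackl_cases:
  assumes "a \<noteq> []"
  obtains (zeros) "set a \<subseteq> {0}"
  | (snoc) c j where "a = c @ [Suc j]"
  | (reset) c x j where "a = c @ Suc x # replicate (Suc j) 0"
proof -
  from zeros_or_last_nonzero[of a] show ?thesis
  proof (elim disjE exE)
    fix k assume "a = replicate k 0"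
    then show ?thesis by (intro zeros) auto
  next
    fix c x j assume "a = c @ Suc x # replicate j 0"
    then show ?thesis using snoc reset by (cases j) auto
  qed
qed

lemma lex_lessI: "x < (x'::nat) \<Longrightarrow> length bs = length as \<Longrightarrow> (c @ x # bs, c @ x' # as) \<in> lex less_than"
  by (auto simp: lex_conv)

text \<open>\<open>c @ [j]\<close> is the immediate lexicographic predecessor, and it is the index
  to which the second and third Ackermann equations descend.\<close>

lemma lexbelow_snoc:
  assumes "lexbelow z b (c @ [Suc j])"
  shows "b = c @ [j] \<or> lexbelow z b (c @ [j])"
proof -
  from assms obtain d x bs x' as where *: "b = d @ x # bs" "c @ [Suc j] = d @ x' # as" "x < x'"
    "length bs = length as" "\<forall>v\<in>set bs. v < z" unfolding lexbelow_def by blast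
  show ?thesis
  proof (cases as rule: rev_cases)
    case Nil
    with * have "d = c" "x' = Suc j" "bs = []" by auto
    then show ?thesis using * lexbelowI[of x j "[]" "[]" z c] by (cases "x = j") auto
  next
    case (snoc as' y)
    then have "c @ [j] = d @ x' # (as' @ [j])" using *(2) by simp
    moreover have "length bs = length (as' @ [j])" using * snoc by simp
    ultimately show ?thesis using * unfolding lexbelow_def by blast
  qed
qed

text \<open>The index on the right of the reset equation at argument \<open>z\<close> still lies
  above every admissible \<open>b\<close>: the entry put in place of the first zero is
  \<open>z\<close> itself, and the entries of \<open>b\<close> behind the difference are strictly
  smaller.\<close>

lemma lexbelow_reset:
  assumes "lexbelow z b (c @ Suc x # replicate (Suc j) 0)"
  shows "lexbelow z b (c @ x # z # replicate j 0)"
proof -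
  from assms obtain d u bs u' as where *: "b = d @ u # bs"
    "c @ Suc x # replicate (Suc j) 0 = d @ u' # as" "u < u'"
    "length bs = length as" "\<forall>v\<in>set bs. v < z" unfolding lexbelow_def by blast
  from *(2) consider (eq) "d = c" "u' = Suc x" "as = replicate (Suc j) 0"
    | (less) us where "c = d @ u' # us" "as = us @ Suc x # replicate (Suc j) 0"
    | (gr) us where "d = c @ Suc x # us" "replicate (Suc j) 0 = us @ u' # as"
    by (auto simp del: replicate_Suc simp: append_eq_append_conv2 append_eq_Cons_conv Cons_eq_append_conv)
  then show ?thesis
  proof cases
    case eq
    then obtain v bs' where bs: "bs = v # bs'" "length bs' = j" using * by (cases bs) auto
    show ?thesis
    proof (cases "u = x")
      case True
      then have "b = (c @ [x]) @ v # bs'" "c @ x # z # replicate j 0 = (c @ [x]) @ z # replicate j 0"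
        using * eq bs by auto
      then show ?thesis unfolding lexbelow_def using * bs by (metis length_replicate list.set_intros)
    next
      case False
      then show ?thesis unfolding lexbelow_def using * bs eq
        by (intro exI[of _ c] exI[of _ u] exI[of _ bs] exI[of _ x] exI[of _ "z # replicate j 0"]) auto
    qed
  next
    case less
    then have "c @ x # z # replicate j 0 = d @ u' # (us @ x # z # replicate j 0)"
      "length bs = length (us @ x # z # replicate j 0)" using * by auto
    then show ?thesis using * unfolding lexbelow_def by blast
  next
    case gr
    then have "u' \<in> set (replicate (Suc j) 0)" by simp
    then have "u' = 0" by (simp del: replicate_Suc)
    then show ?thesis using * by simp
  qed
qed

text \<open>The three claims are proved together because they need each other: growth in the
  argument for a reset index compares two different smaller indices, and the index comparison for a
  successor index uses inflation and monotonicity.\<close>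

lemma ackl_basic:
  assumes "a \<noteq> []"
  shows "(\<forall>y. y < ackl a y) \<and> (\<forall>y. ackl a y < ackl a (Suc y)) \<and>
    (\<forall>b z. lexbelow z b a \<longrightarrow> ackl b z \<le> ackl a z)"
  using assms
proof (induction a rule: wf_induct_rule[OF wf_lex[OF wf_less_than]])
  case (1 a)
  note IH = 1(1)
  from 1(2) show ?case
  proof (cases rule: ackl_cases)
    case zeros
    have "\<not> lexbelow z b a" for z b
    proof
      assume "lexbelow z b a"
      then obtain x' where "x' \<in> set a" "0 < x'" unfolding lexbelow_def by fastforce
      then show False using zeros by auto
    qed
    then show ?thesis using zeros 1(2) by (simp add: ackl_zeros)
  next
    case (snoc c j)
    have lt: "(c @ [j], a) \<in> lex less_than" unfolding snoc by (rule lex_lessI) auto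
    have gt: "y < ackl (c @ [j]) y" and mono: "ackl (c @ [j]) y < ackl (c @ [j]) (Suc y)"
      and low: "lexbelow z b (c @ [j]) \<Longrightarrow> ackl b z \<le> ackl (c @ [j]) z" for y b z
      using IH[OF lt] by auto
    have inc: "ackl a y < ackl a (Suc y)" for y
      using gt snoc ackl_snoc_Suc by simp
    have big: "y < ackl a y" for y
    proof (induction y)
      case 0
      then show ?case using gt[of 1] snoc ackl_snoc_0[of c j] by simp
    next
      case (Suc y)
      then show ?case using inc[of y] by simp
    qed
    have "ackl b z \<le> ackl a z" if "lexbelow z b a" for b z
    proof -
      have "ackl b z \<le> ackl (c @ [j]) z" using lexbelow_snoc that low snoc by blast
      also have "\<dots> \<le> ackl a z"
      proof (cases z)
        case 0
        then show ?thesis using snoc ackl_snoc_0 mono[of 0] by (simp add: less_imp_le)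
      next
        case (Suc y)
        have "mono (ackl (c @ [j]))" using mono by (simp add: mono_iff_le_Suc less_imp_le)
        then show ?thesis using snoc ackl_snoc_Suc Suc big[of y] by (simp add: monoD)
      qed
      finally show ?thesis .
    qed
    then show ?thesis using inc big by blast
  next
    case (reset c x j)
    have lt: "(c @ x # y # replicate j 0, a) \<in> lex less_than" for y
      unfolding reset by (rule lex_lessI) auto
    have gt: "z < ackl (c @ x # y # replicate j 0) z"
      and mono: "ackl (c @ x # y # replicate j 0) z < ackl (c @ x # y # replicate j 0) (Suc z)"
      and low: "lexbelow z b (c @ x # y # replicate j 0) \<Longrightarrow> ackl b z \<le> ackl (c @ x # y # replicate j 0) z"
      for y z b
      using IH[OF lt[of y]] by auto
    have eq: "ackl a y = ackl (c @ x # y # replicate j 0) y" for y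
      unfolding reset by (rule ackl_reset)
    have "ackl a y < ackl a (Suc y)" for y
    proof -
      \<comment> \<open>Raising \<open>y\<close> also raises the reset entry; the trailing zeros are
        below \<open>Suc y\<close>, so the index comparison applies at that argument.\<close>
      have "lexbelow (Suc y) (c @ x # y # replicate j 0) (c @ x # Suc y # replicate j 0)"
        using lexbelowI[of y "Suc y" "replicate j 0" "replicate j 0" "Suc y" "c @ [x]"]
        by (auto split: if_splits)
      from low[OF this] show ?thesis unfolding eq using mono[of y y] by simp
    qed
    moreover have "ackl b z \<le> ackl a z" if "lexbelow z b a" for b z
      unfolding eq by (rule low) (use lexbelow_reset that reset in blast)
    ultimately show ?thesis using gt eq by auto
  qed
qed

lemma ackl_gt: "a \<noteq> [] \<Longrightarrow> y < ackl a y"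
  using ackl_basic by blast

lemma ackl_mono: "a \<noteq> [] \<Longrightarrow> y \<le> z \<Longrightarrow> ackl a y \<le> ackl a z"
  using ackl_basic lift_Suc_mono_le[of "ackl a" y z] less_imp_le by blast

text \<open>The trade between argument and last index entry that later absorbs additive constants
  and shifted arguments.\<close>

lemma ackl_snoc_Suc_arg: "ackl (c @ [j]) (Suc y) \<le> ackl (c @ [Suc j]) y"
proof (induction y)
  case 0
  then show ?case by (simp add: ackl_snoc_0)
next
  case (Suc y)
  have "Suc (Suc y) \<le> ackl (c @ [Suc j]) y"
    using ackl_gt[of "c @ [j]" "Suc y"] Suc by simp
  then show ?case using ackl_mono[of "c @ [j]"] by (simp add: ackl_snoc_Suc)
qed

lemma ackl_snoc_mono: "j \<le> j' \<Longrightarrow> ackl (c @ [j]) y \<le> ackl (c @ [j']) y"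
proof (rule lift_Suc_mono_le[of "\<lambda>j. ackl (c @ [j]) y"])
  show "ackl (c @ [j]) y \<le> ackl (c @ [Suc j]) y" for j
    using ackl_snoc_Suc_arg[of c j y] ackl_mono[of "c @ [j]" y "Suc y"] by simp
qed

lemma ackl_add: "ackl (c @ [j]) (y + n) \<le> ackl (c @ [j + n]) y"
proof (induction n arbitrary: j)
  case (Suc n)
  show ?case using ackl_snoc_Suc_arg[of c j "y + n"] Suc[of "Suc j"] by simp
qed simp

text \<open>The branch with last entry \<open>Suc j\<close> iterates the one with \<open>j\<close>:
  starting from \<open>y < ackl (c @ [Suc j]) y\<close>, each iteration is one unfolding of the
  recursion.\<close>

lemma ackl_funpow_arg: "(ackl (c @ [j]) ^^ n) y \<le> ackl (c @ [Suc j]) (y + n)"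
proof (induction n)
  case 0
  then show ?case using ackl_gt[of "c @ [Suc j]" y] by simp
next
  case (Suc n)
  then show ?case using ackl_mono[of "c @ [j]"] by (simp add: ackl_snoc_Suc)
qed

lemma ackl_funpow: "(ackl (c @ [j]) ^^ n) y \<le> ackl (c @ [Suc j + n]) y"
  using ackl_funpow_arg ackl_add le_trans by blast

text \<open>No equation changes anything to the left of the last nonzero index entry, so leading
  zeros are inert and branches of different arity can be padded to a common length.\<close>

lemma ackl_Cons_0: "a \<noteq> [] \<Longrightarrow> ackl (0 # a) y = ackl a y"
proof (induction a arbitrary: y rule: wf_induct_rule[OF wf_lex[OF wf_less_than]])
  case (1 a)
  note IH = 1(1)
  from 1(2) show ?case
  proof (cases rule: ackl_cases)
    case zeros
    then show ?thesis using 1(2) by (simp add: ackl_zeros)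
  next
    case (snoc c j)
    have lt: "(c @ [j], a) \<in> lex less_than" unfolding snoc by (rule lex_lessI) auto
    show ?thesis
    proof (induction y)
      case 0
      then show ?case using IH[OF lt] snoc ackl_snoc_0[of "0 # c" j] by (simp add: ackl_snoc_0)
    next
      case (Suc y)
      then show ?case using IH[OF lt] snoc ackl_snoc_Suc[of "0 # c" j] by (simp add: ackl_snoc_Suc)
    qed
  next
    case (reset c x j)
    have lt: "(c @ x # y # replicate j 0, a) \<in> lex less_than" for y
      unfolding reset by (rule lex_lessI) auto
    show ?thesis unfolding reset using IH[OF lt] ackl_reset[of "0 # c" x j] ackl_reset[of c x j]
      by (simp del: replicate_Suc)
  qed
qed

lemma ackl_pad: "a \<noteq> [] \<Longrightarrow> ackl (replicate n 0 @ a) y = ackl a y"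
  by (induction n) (auto simp: ackl_Cons_0)

text \<open>Diagonalisation: a unit in front of enough zeros is above every index of bounded length,
  provided that the argument exceeds the entries, which is the side condition of
  \<open>lexbelow\<close>.\<close>

lemma ackl_less_unit:
  assumes "a \<noteq> []" "length a \<le> n" "\<And>v. v \<in> set a \<Longrightarrow> v < y"
  shows "ackl a y \<le> ackl (1 # replicate n 0) y"
proof (cases "y = 0")
  case True
  then show ?thesis using assms by (cases a) auto
next
  case False
  have "lexbelow y ([] @ 0 # (replicate (n - length a) 0 @ a)) ([] @ 1 # replicate n 0)"
    by (rule lexbelowI) (use assms False in auto)
  then have "ackl (0 # (replicate (n - length a) 0 @ a)) y \<le> ackl (1 # replicate n 0) y"
    using ackl_basic by simp
  then show ?thesis using assms ackl_pad ackl_Cons_0 by simp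
qed

text \<open>The condition on the entries is met by shifting the argument past the largest of them;
  the additional last place of the index pays for the shift.\<close>

lemma ackl_le_unit:
  assumes "a \<noteq> []" "length a \<le> n"
  shows "\<exists>N. \<forall>y. ackl a y \<le> ackl (1 # replicate n 0 @ [N]) y"
proof (intro exI allI)
  fix y
  let ?N = "Suc (Max (set a))"
  have lt: "v < y + ?N" if "v \<in> set a" for v
    using that Max_ge[of "set a" v] by (simp add: less_Suc_eq_le trans_le_add2)
  have "ackl a y \<le> ackl a (y + ?N)" using assms ackl_mono by simp
  also have "\<dots> \<le> ackl (1 # replicate (Suc n) 0) (y + ?N)"
    by (rule ackl_less_unit) (use assms lt in auto)
  also have "1 # replicate (Suc n) 0 = (1 # replicate n 0) @ [0::nat]"
    by (simp add: replicate_append_same)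
  also have "ackl ((1 # replicate n 0) @ [0]) (y + ?N) \<le> ackl ((1 # replicate n 0) @ [?N]) y"
    using ackl_add[of "1 # replicate n 0" 0 y ?N] by (simp only: add_0)
  finally show "ackl a y \<le> ackl (1 # replicate n 0 @ [?N]) y" by simp
qed

lemma ackl_common2:
  assumes "a \<noteq> []" "b \<noteq> []"
  shows "\<exists>c j. \<forall>y. ackl a y \<le> ackl (c @ [j]) y \<and> ackl b y \<le> ackl (c @ [j]) y"
proof -
  let ?n = "max (length a) (length b)" let ?c = "1 # replicate ?n 0"
  obtain N where N: "\<And>y. ackl a y \<le> ackl (?c @ [N]) y"
    using ackl_le_unit[OF assms(1), of ?n] by auto
  obtain K where K: "\<And>y. ackl b y \<le> ackl (?c @ [K]) y"
    using ackl_le_unit[OF assms(2), of ?n] by auto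
  have "ackl a y \<le> ackl (?c @ [max N K]) y" "ackl b y \<le> ackl (?c @ [max N K]) y" for y
    using N[of y] K[of y] ackl_snoc_mono[of N "max N K" ?c y] ackl_snoc_mono[of K "max N K" ?c y]
    by linarith+
  then show ?thesis by blast
qed

section \<open>Domination by a single branch and its closure properties\<close>

definition dominated :: "(nat \<Rightarrow> nat) \<Rightarrow> bool" where
  "dominated h \<longleftrightarrow> (\<exists>c j. \<forall>y. h y \<le> ackl (c @ [j]) y)"

lemma dominatedI: "a \<noteq> [] \<Longrightarrow> (\<And>y. h y \<le> ackl a y) \<Longrightarrow> dominated h"
  unfolding dominated_def by (metis append_butlast_last_id)

lemma dominatedE:
  assumes "dominated h"
  obtains c j where "\<And>y. h y \<le> ackl (c @ [j]) y"
  using assms unfolding dominated_def by blast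

lemma dominated_le: "dominated h \<Longrightarrow> (\<And>y. f y \<le> h y) \<Longrightarrow> dominated f"
  unfolding dominated_def by (meson le_trans)

lemma dominated_id: "dominated (\<lambda>y. y)"
  using dominatedI[of "[0]" "\<lambda>y. y"] ackl_gt[of "[0]"] by (simp add: less_imp_le)

lemma dominated_Suc: "dominated Suc"
  using dominatedI[of "[0]" Suc] by (simp add: ackl_zeros)

lemma dominated_const: "dominated (\<lambda>y. n)"
proof (rule dominatedI)
  fix y
  have "n \<le> ackl [0] (y + n)" by (simp add: ackl_zeros)
  also have "\<dots> \<le> ackl [n] y" using ackl_add[of "[]" 0 y n] by simp
  finally show "n \<le> ackl [n] y" .
qed simp

lemma dominated_common2:
  assumes "dominated f" "dominated h"
  obtains c j where "\<And>y. f y \<le> ackl (c @ [j]) y" "\<And>y. h y \<le> ackl (c @ [j]) y"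
proof -
  obtain a i where f: "\<And>y. f y \<le> ackl (a @ [i]) y" using assms dominatedE by blast
  obtain b k where h: "\<And>y. h y \<le> ackl (b @ [k]) y" using assms dominatedE by blast
  obtain c j where "\<forall>y. ackl (a @ [i]) y \<le> ackl (c @ [j]) y \<and> ackl (b @ [k]) y \<le> ackl (c @ [j]) y"
    using ackl_common2[of "a @ [i]" "b @ [k]"] by auto
  then show ?thesis using that f h le_trans by meson
qed

lemma dominated_comp:
  assumes "dominated f" "dominated h"
  shows "dominated (\<lambda>y. f (h y))"
proof -
  obtain c j where *: "\<And>y. f y \<le> ackl (c @ [j]) y" "\<And>y. h y \<le> ackl (c @ [j]) y"
    by (rule dominated_common2[OF assms]) blast
  have "f (h y) \<le> ackl (c @ [Suc j + 2]) y" for y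
  proof -
    have "f (h y) \<le> ackl (c @ [j]) (ackl (c @ [j]) y)"
      using *(1)[of "h y"] ackl_mono[OF _ *(2)[of y], where a = "c @ [j]"] by simp
    also have "\<dots> \<le> ackl (c @ [Suc j + 2]) y" using ackl_funpow[where c = c and j = j and n = 2 and y = y]
      by (simp add: numeral_2_eq_2)
    finally show ?thesis .
  qed
  then show ?thesis by (rule dominatedI[rotated]) simp
qed

lemma dominated_max: "dominated f \<Longrightarrow> dominated h \<Longrightarrow> dominated (\<lambda>y. max (f y) (h y))"
proof -
  assume "dominated f" "dominated h"
  then obtain c j where *: "\<And>y. f y \<le> ackl (c @ [j]) y" "\<And>y. h y \<le> ackl (c @ [j]) y"
    by (rule dominated_common2) blast
  show ?thesis by (rule dominatedI[of "c @ [j]"]) (simp_all add: *)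
qed

lemma ackl_1: "ackl [Suc 0] y = y + 2"
proof (induction y)
  case 0
  show ?case using ackl_snoc_0[of "[]" 0] by (simp add: ackl_zeros)
next
  case (Suc y)
  then show ?case using ackl_snoc_Suc[of "[]" 0 y] by (simp add: ackl_zeros)
qed

lemma ackl_2: "ackl [Suc (Suc 0)] y = 2 * y + 3"
proof (induction y)
  case 0
  show ?case using ackl_snoc_0[of "[]" "Suc 0"] by (simp add: ackl_1)
next
  case (Suc y)
  then show ?case using ackl_snoc_Suc[of "[]" "Suc 0" y] by (simp add: ackl_1)
qed

text \<open>A sum is at most twice the maximum, and doubling stays below the branch with index
  2.\<close>

lemma dominated_add:
  assumes "dominated f" "dominated h"
  shows "dominated (\<lambda>y. f y + h y)"
proof -
  have "dominated (\<lambda>y. 2 * y)" by (rule dominatedI[of "[Suc (Suc 0)]"]) (auto simp: ackl_2)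
  from dominated_comp[OF this dominated_max[OF assms]]
  have "dominated (\<lambda>y. 2 * max (f y) (h y))" .
  then show ?thesis by (rule dominated_le) simp
qed

lemma dominated_mult: "dominated f \<Longrightarrow> dominated (\<lambda>y. n * f y)"
proof (induction n)
  case 0
  show ?case using dominated_const[of 0] by simp
next
  case (Suc n)
  then show ?case using dominated_add[of f "\<lambda>y. n * f y"] by simp
qed

lemma dominated_finite:
  assumes "finite S" "\<And>s. s \<in> S \<Longrightarrow> dominated (f s)"
  shows "\<exists>c j. \<forall>s\<in>S. \<forall>y. f s y \<le> ackl (c @ [j]) y"
  using assms
proof (induction S)
  case empty
  then show ?case by simp
next
  case (insert s S)
  then obtain c j where *: "\<forall>s\<in>S. \<forall>y. f s y \<le> ackl (c @ [j]) y" by blast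
  have "dominated (f s)" "dominated (ackl (c @ [j]))"
    using insert.prems dominatedI[of "c @ [j]"] by auto
  from dominated_common2[OF this] obtain d k where
    "\<And>y. f s y \<le> ackl (d @ [k]) y" "\<And>y. ackl (c @ [j]) y \<le> ackl (d @ [k]) y" by metis
  with * have "f t y \<le> ackl (d @ [k]) y" if "t \<in> insert s S" for t y
    using that le_trans by blast
  then show ?case by blast
qed

text \<open>An arbitrary common upper bound \<open>y\<close> of the arguments takes the place of
  their maximum, so that arity 0 is covered as well.\<close>

definition list_dominated :: "nat \<Rightarrow> (nat list \<Rightarrow> nat) \<Rightarrow> bool" where
  "list_dominated n f \<longleftrightarrow>
     (\<exists>h. dominated h \<and> (\<forall>xs y. length xs = n \<longrightarrow> (\<forall>x\<in>set xs. x \<le> y) \<longrightarrow> f xs \<le> h y))"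

lemma list_dominatedI:
  "dominated h \<Longrightarrow> (\<And>xs y. length xs = n \<Longrightarrow> (\<And>x. x \<in> set xs \<Longrightarrow> x \<le> y) \<Longrightarrow> f xs \<le> h y) \<Longrightarrow>
    list_dominated n f"
  unfolding list_dominated_def by blast

lemma list_dominatedE:
  assumes "list_dominated n f"
  obtains c j where
    "\<And>xs y. length xs = n \<Longrightarrow> (\<And>x. x \<in> set xs \<Longrightarrow> x \<le> y) \<Longrightarrow> f xs \<le> ackl (c @ [j]) y"
  using assms unfolding list_dominated_def dominated_def by (meson le_trans)

lemma list_dominated_ack:
  assumes "2 \<le> k"
  shows "list_dominated k ack"
proof (rule list_dominatedI)
  \<comment> \<open>\<open>Suc y\<close> lies strictly above all arguments, as the diagonal
    comparison requires.\<close>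
  show "dominated (\<lambda>y. ackl (1 # replicate (k - 1) 0) (Suc y))"
    by (rule dominated_comp[OF _ dominated_Suc]) (rule dominatedI[of "1 # replicate (k - 1) 0"], auto)
next
  fix xs y assume len: "length xs = k" and le: "\<And>x. x \<in> set xs \<Longrightarrow> x \<le> (y::nat)"
  obtain a z where xs: "xs = a @ [z]" using assms len by (cases xs rule: rev_cases) auto
  have "ack xs = ackl a z" by (simp add: xs ackl_def)
  also have "\<dots> \<le> ackl a (Suc y)" using le[of z] xs assms len by (intro ackl_mono) auto
  also have "\<dots> \<le> ackl (1 # replicate (k - 1) 0) (Suc y)"
    by (rule ackl_less_unit) (use assms len le xs in \<open>auto simp: less_Suc_eq_le\<close>)
  finally show "ack xs \<le> ackl (1 # replicate (k - 1) 0) (Suc y)" .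
qed

text \<open>If one branch \<open>?D\<close> bounds both the base and the step function, the value
  after \<open>x\<close> rounds is below the \<open>Suc x\<close>-fold iterate of \<open>?D\<close>,
  and a larger last index entry bounds these iterates uniformly in \<open>x\<close>.\<close>

lemma list_dominated_prim_rec:
  assumes "list_dominated n f" "list_dominated (Suc (Suc n)) g"
  shows "list_dominated (Suc n) (\<lambda>xs. rec_nat (f (tl xs)) (\<lambda>y r. g (y # r # tl xs)) (hd xs))"
proof -
  obtain hf where hf: "dominated hf"
    "\<And>xs y. length xs = n \<Longrightarrow> (\<And>x. x \<in> set xs \<Longrightarrow> x \<le> y) \<Longrightarrow> f xs \<le> hf y"
    using assms(1) unfolding list_dominated_def by blast
  obtain hg where hg: "dominated hg"
    "\<And>xs y. length xs = Suc (Suc n) \<Longrightarrow> (\<And>x. x \<in> set xs \<Longrightarrow> x \<le> y) \<Longrightarrow> g xs \<le> hg y"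
    using assms(2) unfolding list_dominated_def by blast
  obtain c j where D: "\<And>y. hf y \<le> ackl (c @ [j]) y" "\<And>y. hg y \<le> ackl (c @ [j]) y"
    using dominated_common2[OF hf(1) hg(1)] by metis
  let ?D = "ackl (c @ [j])"
  have iter: "y \<le> (?D ^^ m) y" for m y
  proof (induction m)
    case (Suc m)
    then show ?case using ackl_gt[of "c @ [j]" "(?D ^^ m) y"] by simp
  qed simp
  have rec: "rec_nat (f ys) (\<lambda>y r. g (y # r # ys)) x \<le> (?D ^^ Suc x) y"
    if "length ys = n" "\<And>v. v \<in> set ys \<Longrightarrow> v \<le> y" "x \<le> y" for x y ys
    using that(3)
  proof (induction x)
    case 0
    then show ?case using hf(2)[of ys y] D(1)[of y] that by simp
  next
    case (Suc x)
    let ?r = "rec_nat (f ys) (\<lambda>y r. g (y # r # ys)) x"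
    have "?r \<le> (?D ^^ Suc x) y" using Suc by simp
    then have "g (x # ?r # ys) \<le> hg ((?D ^^ Suc x) y)"
      using that Suc iter[of y "Suc x"] by (intro hg(2)) (auto dest!: that(2) simp del: funpow.simps)
    then show ?case using D(2)[of "(?D ^^ Suc x) y"] by simp
  qed
  have "dominated (\<lambda>y. ackl (c @ [Suc j]) (y + Suc y))"
    by (rule dominated_comp[OF _ dominated_add[OF dominated_id dominated_Suc]])
      (rule dominatedI[of "c @ [Suc j]"], auto)
  then show ?thesis
  proof (rule list_dominatedI)
    fix xs y assume xs: "length xs = Suc n" "\<And>x. x \<in> set xs \<Longrightarrow> x \<le> (y::nat)"
    then obtain x ys where *: "xs = x # ys" by (cases xs) auto
    have "rec_nat (f ys) (\<lambda>y r. g (y # r # ys)) x \<le> (?D ^^ Suc x) y"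
      by (rule rec) (use xs * in auto)
    also have "\<dots> \<le> ackl (c @ [Suc j]) (y + Suc x)" by (rule ackl_funpow_arg)
    also have "\<dots> \<le> ackl (c @ [Suc j]) (y + Suc y)" using xs * by (intro ackl_mono) auto
    finally show "rec_nat (f (tl xs)) (\<lambda>y r. g (y # r # tl xs)) (hd xs) \<le>
      ackl (c @ [Suc j]) (y + Suc y)" using * by simp
  qed
qed

lemma multiply_recursive_dominated: "multiply_recursive n f \<Longrightarrow> list_dominated n f"
proof (induction rule: multiply_recursive.induct)
  case (zero n)
  then show ?case using dominated_const by (rule list_dominatedI) simp
next
  case succ
  show ?case by (rule list_dominatedI[OF dominated_Suc]) simp
next
  case (proj i n)
  then show ?case by (intro list_dominatedI[OF dominated_id]) simp
next
  case (ack k)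
  then show ?case by (rule list_dominated_ack)
next
  case (comp gs f n)
  obtain hf where hf: "dominated hf"
    "\<And>xs y. length xs = length gs \<Longrightarrow> (\<And>x. x \<in> set xs \<Longrightarrow> x \<le> y) \<Longrightarrow> f xs \<le> hf y"
    using comp.IH(1) unfolding list_dominated_def by blast
  have "\<forall>g\<in>set gs. \<exists>h. dominated h \<and>
    (\<forall>xs y. length xs = n \<longrightarrow> (\<forall>x\<in>set xs. x \<le> y) \<longrightarrow> g xs \<le> h y)"
    using comp.IH(2) unfolding list_dominated_def by blast
  from bchoice[OF this] obtain h where h: "\<And>g. g \<in> set gs \<Longrightarrow> dominated (h g)"
    "\<And>g xs y. g \<in> set gs \<Longrightarrow> length xs = n \<Longrightarrow> (\<And>x. x \<in> set xs \<Longrightarrow> x \<le> y) \<Longrightarrow> g xs \<le> h g y"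
    by blast
  obtain c j where D: "\<And>g y. g \<in> set gs \<Longrightarrow> h g y \<le> ackl (c @ [j]) y"
    using dominated_finite[of "set gs" h, OF finite_set h(1)] by blast
  have "dominated (\<lambda>y. hf (ackl (c @ [j]) y))"
    by (rule dominated_comp[OF hf(1)]) (rule dominatedI[of "c @ [j]"], auto)
  then show ?case
  proof (rule list_dominatedI)
    fix xs y assume xs: "length xs = n" "\<And>x. x \<in> set xs \<Longrightarrow> x \<le> (y::nat)"
    show "f (map (\<lambda>g. g xs) gs) \<le> hf (ackl (c @ [j]) y)"
    proof (rule hf(2))
      fix x assume "x \<in> set (map (\<lambda>g. g xs) gs)"
      then obtain g where g: "g \<in> set gs" "x = g xs" by auto
      have "g xs \<le> h g y" by (rule h(2)) (use g xs in auto)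
      with D[OF g(1), of y] g(2) show "x \<le> ackl (c @ [j]) y" by simp
    qed simp
  qed
next
  case (prim_rec n f g)
  then show ?case by (blast intro: list_dominated_prim_rec)
next
  case (ext n f f')
  then show ?case unfolding list_dominated_def by simp
qed

lemma multiply_recursive_unary_dominated: "multiply_recursive_unary h \<Longrightarrow> dominated h"
proof -
  assume "multiply_recursive_unary h"
  then have "list_dominated 1 (\<lambda>xs. h (xs ! 0))"
    unfolding multiply_recursive_unary_def by (rule multiply_recursive_dominated)
  then obtain D where "dominated D"
    and le: "\<And>xs y. length xs = 1 \<Longrightarrow> (\<forall>x\<in>set xs. x \<le> y) \<Longrightarrow> h (xs ! 0) \<le> D y"
    unfolding list_dominated_def by blast
  from this(1) show ?thesis using le[of "[y]" y for y] by (auto intro: dominated_le)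
qed

lemma multiply_recursive_const: "multiply_recursive n (\<lambda>xs. c)"
proof (induction c)
  case 0
  show ?case by (rule multiply_recursive.zero)
next
  case (Suc c)
  then show ?case
    using multiply_recursive.comp[of "[\<lambda>xs. c]" "\<lambda>xs. Suc (xs ! 0)" n] multiply_recursive.succ
    by simp
qed

lemma multiply_recursive_unary_const: "multiply_recursive_unary (\<lambda>n. c)"
  unfolding multiply_recursive_unary_def by (rule multiply_recursive_const)

lemma multiply_recursive_unary_ackl:
  assumes "a \<noteq> []"
  shows "multiply_recursive_unary (ackl a)"
proof -
  let ?gs = "map (\<lambda>c xs. c) a @ [\<lambda>xs. xs ! 0]"
  have "multiply_recursive 1 (\<lambda>xs. ack (map (\<lambda>g. g xs) ?gs))"
  proof (rule multiply_recursive.comp)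
    show "multiply_recursive (length ?gs) ack"
      using assms by (intro multiply_recursive.ack) (cases a, auto)
    show "multiply_recursive 1 g" if "g \<in> set ?gs" for g
      using that multiply_recursive.proj[of 0 1] multiply_recursive_const by auto
  qed
  then show ?thesis by (simp add: multiply_recursive_unary_def ackl_def comp_def)
qed

subsection \<open>Terms and bounds on derivations\<close>

lemma supteq_refl [simp]: "supteq t t"
  by (cases t) (auto simp: supteq_def)

lemma supteq_Fun: "supteq (Fun f ts) u \<longleftrightarrow> u = Fun f ts \<or> (\<exists>t\<in>set ts. supteq t u)"
  by (auto simp: supteq_def)

lemma supteq_trans: "supteq s t \<Longrightarrow> supteq t u \<Longrightarrow> supteq s u"
proof (induction s)
  case (Fun f ts)
  then show ?case by (auto simp: supteq_Fun)
qed (simp add: supteq_def)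

lemma supteq_tsize: "supteq s t \<Longrightarrow> tsize t \<le> tsize s"
proof (induction s)
  case (Fun f ts)
  show ?case
  proof (cases "t = Fun f ts")
    case False
    with Fun obtain s where "s \<in> set ts" "tsize t \<le> tsize s" by (auto simp: supteq_Fun)
    then show ?thesis using member_le_sum_list[of "tsize s" "map tsize ts"] by simp
  qed simp
qed (simp add: supteq_def)

lemma supt_Fun: "supt (Fun f ts) u \<longleftrightarrow> (\<exists>t\<in>set ts. supteq t u)"
proof
  show "supt (Fun f ts) u" if "\<exists>t\<in>set ts. supteq t u"
  proof -
    from that obtain t where t: "t \<in> set ts" "supteq t u" by blast
    then have "tsize u < tsize (Fun f ts)"
      using supteq_tsize[OF t(2)] member_le_sum_list[of "tsize t" "map tsize ts"] by simp
    then show ?thesis using t by (auto simp: supt_def supteq_Fun)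
  qed
qed (auto simp: supt_def supteq_Fun)

lemma tsize_pos: "0 < tsize t"
  by (cases t) auto

lemma supteq_subst_var: "x \<in> vars t \<Longrightarrow> supteq (subst t \<sigma>) (\<sigma> x)"
proof (induction t)
  case (Fun f ts)
  then show ?case by (auto simp: supteq_Fun)
qed simp

lemma supteq_subst: "supteq s t \<Longrightarrow> supteq (subst s \<sigma>) (subst t \<sigma>)"
proof (induction s)
  case (Fun f ts)
  then show ?case by (auto simp: supteq_Fun)
qed (auto simp: supteq_def intro: supteq_refl[unfolded supteq_def])

lemma supteq_vars: "supteq s t \<Longrightarrow> vars t \<subseteq> vars s"
proof (induction s)
  case (Fun f ts)
  then show ?case by (fastforce simp: supteq_Fun)
qed (simp add: supteq_def)

lemma subst_cong: "(\<And>x. x \<in> vars t \<Longrightarrow> \<sigma> x = \<tau> x) \<Longrightarrow> subst t \<sigma> = subst t \<tau>"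
  by (induction t) auto

lemma Fun_in_terms: "Fun f ts \<in> terms F \<longleftrightarrow> (f, length ts) \<in> F \<and> set ts \<subseteq> terms F"
  by (auto elim: terms.cases intro: terms.Fun)

lemma Var_in_terms [simp]: "Var x \<in> terms F"
  by (rule terms.Var)

lemma supteq_terms: "supteq s t \<Longrightarrow> s \<in> terms F \<Longrightarrow> t \<in> terms F"
proof (induction s)
  case (Fun f ts)
  then show ?case by (auto simp: supteq_Fun Fun_in_terms)
qed (simp add: supteq_def)

lemma subst_terms:
  "t \<in> terms F \<Longrightarrow> (\<And>x. x \<in> vars t \<Longrightarrow> \<sigma> x \<in> terms F) \<Longrightarrow> subst t \<sigma> \<in> terms F"
  by (induction t) (auto simp: Fun_in_terms)

lemma rstep_terms:
  assumes "trs F R" "(s, t) \<in> rstep R" "s \<in> terms F"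
  shows "t \<in> terms F"
  using assms(2,3)
proof (induction rule: rstep.induct)
  case (root l r \<sigma>)
  then have "r \<in> terms F" "vars r \<subseteq> vars l" using assms(1) by (auto simp: trs_def)
  moreover have "\<sigma> x \<in> terms F" if "x \<in> vars l" for x
    using supteq_terms[OF supteq_subst_var[OF that] root(2)] .
  ultimately show ?case by (intro subst_terms) auto
next
  case (arg s t f ss us)
  then show ?case by (auto simp: Fun_in_terms)
qed

text \<open>Marking affects the root only, so these are the steps that carry over to marked terms as
  steps of the unmarked rules.\<close>

definition argstep :: "'f rule set \<Rightarrow> 'f trm rel" where
  "argstep R = {(Fun f (ss @ s # us), Fun f (ss @ t # us)) | f ss s t us. (s, t) \<in> rstep R}"

lemma argstep_rstep: "argstep R \<subseteq> rstep R"
  by (auto simp: argstep_def intro: rstep.arg)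

lemma rstep_cases:
  assumes "(s, t) \<in> rstep R"
  obtains l r \<sigma> where "(l, r) \<in> R" "s = subst l \<sigma>" "t = subst r \<sigma>" | "(s, t) \<in> argstep R"
  using assms by (cases rule: rstep.cases) (auto simp: argstep_def)

lemma rstep_supteq:
  assumes "supteq u s" "(s, t) \<in> rstep R"
  shows "\<exists>v. (u, v) \<in> rstep R \<and> supteq v t"
  using assms(1)
proof (induction u)
  case (Var x)
  then have "s = Var x" by (simp add: supteq_def)
  with assms(2) show ?case using supteq_refl by blast
next
  case (Fun f ts)
  show ?case
  proof (cases "s = Fun f ts")
    case True
    with assms(2) show ?thesis using supteq_refl by blast
  next
    case False
    with Fun obtain w v where *: "w \<in> set ts" "(w, v) \<in> rstep R" "supteq v t"
      unfolding supteq_Fun by blast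
    then obtain ss us where "ts = ss @ w # us" by (meson split_list)
    then have "(Fun f ts, Fun f (ss @ v # us)) \<in> rstep R" using * by (auto intro: rstep.arg)
    then show ?thesis using * by (auto simp: supteq_Fun)
  qed
qed

lemma rstep_pow_supteq:
  assumes "supteq u s" "(s, t) \<in> rstep R ^^ n"
  shows "\<exists>v. (u, v) \<in> rstep R ^^ n \<and> supteq v t"
  using assms(2)
proof (induction n arbitrary: t)
  case 0
  then show ?case using assms(1) by auto
next
  case (Suc n)
  then obtain t' where "(s, t') \<in> rstep R ^^ n" "(t', t) \<in> rstep R" by auto
  with Suc.IH obtain v' where "(u, v') \<in> rstep R ^^ n" "supteq v' t'" by blast
  moreover obtain v where "(v', v) \<in> rstep R" "supteq v t"
    using rstep_supteq \<open>(t', t) \<in> rstep R\<close> \<open>supteq v' t'\<close> by blast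
  ultimately show ?case by auto
qed

section \<open>Bounds on derivation length plus size of the reduct\<close>

definition bounded_by :: "'f rule set \<Rightarrow> nat \<Rightarrow> 'f trm \<Rightarrow> bool" where
  "bounded_by R n t \<longleftrightarrow> (\<forall>k t'. (t, t') \<in> rstep R ^^ k \<longrightarrow> k + tsize t' \<le> n)"

lemma bounded_by_tsize: "bounded_by R n t \<Longrightarrow> tsize t \<le> n"
  unfolding bounded_by_def by (metis add_0 relpow_0_I)

lemma not_bounded_by_0: "\<not> bounded_by R 0 t"
  using bounded_by_tsize tsize_pos by (metis leD)

lemma bounded_by_mono: "bounded_by R n t \<Longrightarrow> n \<le> k \<Longrightarrow> bounded_by R k t"
  unfolding bounded_by_def by (meson le_trans)

lemma bounded_by_step: "bounded_by R (Suc n) t \<Longrightarrow> (t, t') \<in> rstep R \<Longrightarrow> bounded_by R n t'"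
  unfolding bounded_by_def
proof (intro allI impI)
  fix k u assume *: "\<forall>k u. (t, u) \<in> rstep R ^^ k \<longrightarrow> k + tsize u \<le> Suc n"
    "(t, t') \<in> rstep R" "(t', u) \<in> rstep R ^^ k"
  then have "(t, u) \<in> rstep R ^^ Suc k" by (meson relpow_Suc_I2)
  with * have "Suc k + tsize u \<le> Suc n" by blast
  then show "k + tsize u \<le> n" by simp
qed

lemma bounded_by_SucI:
  assumes "tsize t \<le> Suc n" "\<And>t'. (t, t') \<in> rstep R \<Longrightarrow> bounded_by R n t'"
  shows "bounded_by R (Suc n) t"
  unfolding bounded_by_def
proof (intro allI impI)
  fix k u assume *: "(t, u) \<in> rstep R ^^ k"
  show "k + tsize u \<le> Suc n"
  proof (cases k)
    case 0
    then show ?thesis using * assms(1) by simp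
  next
    case (Suc k')
    then obtain t' where "(t, t') \<in> rstep R" "(t', u) \<in> rstep R ^^ k'"
      using * by (meson relpow_Suc_D2)
    then have "k' + tsize u \<le> n" using assms(2) unfolding bounded_by_def by blast
    then show ?thesis using Suc by simp
  qed
qed

lemma bounded_by_supteq:
  assumes "bounded_by R n t" "supteq t u"
  shows "bounded_by R n u"
  unfolding bounded_by_def
proof (intro allI impI)
  fix k u' assume "(u, u') \<in> rstep R ^^ k"
  with assms(2) obtain v where "(t, v) \<in> rstep R ^^ k" "supteq v u'"
    using rstep_pow_supteq by blast
  then have "k + tsize v \<le> n" "tsize u' \<le> tsize v"
    using assms(1) supteq_tsize unfolding bounded_by_def by blast+
  then show "k + tsize u' \<le> n" by simp
qed

text \<open>A proper subterm of \<open>t\<close> always has a smaller bound, because the surrounding context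
  contributes to the size of every reduct of \<open>t\<close>; hence the least bound decreases along rewrite
  steps as well as along the proper subterm relation.\<close>

lemma bounded_by_Fun_arg:
  assumes "bounded_by R (Suc n) (Fun f ts)" "s \<in> set ts"
  shows "bounded_by R n s"
  unfolding bounded_by_def
proof (intro allI impI)
  fix k s' assume *: "(s, s') \<in> rstep R ^^ k"
  obtain ss us where ts: "ts = ss @ s # us" using assms(2) by (meson split_list)
  have "(Fun f (ss @ s # us), Fun f (ss @ s' # us)) \<in> rstep R ^^ k" using *
  proof (induction k arbitrary: s')
    case (Suc k)
    then obtain v where "(Fun f (ss @ s # us), Fun f (ss @ v # us)) \<in> rstep R ^^ k"
      "(v, s') \<in> rstep R" by auto
    then show ?case by (auto intro: rstep.arg)
  qed simp
  then have "k + tsize (Fun f (ss @ s' # us)) \<le> Suc n"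
    using assms(1) ts unfolding bounded_by_def by blast
  then show "k + tsize s' \<le> n" by simp
qed

lemma bounded_by_supt:
  assumes "bounded_by R (Suc n) t" "supt t u"
  shows "bounded_by R n u"
proof (cases t)
  case (Fun f ts)
  then obtain s where "s \<in> set ts" "supteq s u" using assms(2) by (auto simp: supt_Fun)
  moreover have "bounded_by R n s" using bounded_by_Fun_arg assms(1) Fun \<open>s \<in> set ts\<close> by metis
  ultimately show ?thesis using bounded_by_supteq by metis
qed (use assms(2) in \<open>auto simp: supt_def supteq_def\<close>)

definition sn :: "'f rule set \<Rightarrow> 'f trm \<Rightarrow> bool" where
  "sn R t \<longleftrightarrow> (\<exists>n. bounded_by R n t)"

definition least_bound :: "'f rule set \<Rightarrow> 'f trm \<Rightarrow> nat" where
  "least_bound R t = (LEAST n. bounded_by R n t)"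

lemma snI: "bounded_by R n t \<Longrightarrow> sn R t"
  unfolding sn_def by blast

lemma least_bound_le: "bounded_by R n t \<Longrightarrow> least_bound R t \<le> n"
  unfolding least_bound_def by (rule Least_le)

lemma bounded_by_least_bound: "sn R t \<Longrightarrow> bounded_by R (least_bound R t) t"
  unfolding sn_def least_bound_def by (erule exE) (rule LeastI)

lemma tsize_least_bound: "sn R t \<Longrightarrow> tsize t \<le> least_bound R t"
  using bounded_by_least_bound bounded_by_tsize by blast

lemma least_bound_step:
  assumes "sn R t" "(t, u) \<in> rstep R \<or> supt t u"
  shows "sn R u" "least_bound R u < least_bound R t"
proof -
  obtain n where n: "least_bound R t = Suc n"
    using bounded_by_least_bound[OF assms(1)] not_bounded_by_0 by (metis not0_implies_Suc)
  then have "bounded_by R (Suc n) t" using bounded_by_least_bound[OF assms(1)] by simp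
  then have "bounded_by R n u" using assms(2) bounded_by_step bounded_by_supt by blast
  then show "sn R u" "least_bound R u < least_bound R t"
    using least_bound_le[of R n u] n by (auto intro: snI)
qed

lemma least_bound_supteq:
  assumes "sn R t" "supteq t u"
  shows "sn R u" "least_bound R u \<le> least_bound R t"
  using bounded_by_supteq[OF bounded_by_least_bound[OF assms(1)] assms(2)]
  by (auto intro: snI least_bound_le)

text \<open>Steps below the root lower the sum of the least bounds of the arguments, and this sum
  also covers the sizes; the first root step leads to a term bounded by \<open>X\<close>.\<close>

lemma bounded_by_Fun:
  assumes "\<forall>s\<in>set ts. sn R s"
    and "\<And>t' l r \<sigma>. (Fun f ts, t') \<in> (argstep R)\<^sup>* \<Longrightarrow> (l, r) \<in> R \<Longrightarrow> t' = subst l \<sigma> \<Longrightarrow>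
      bounded_by R X (subst r \<sigma>)"
  shows "bounded_by R (Suc (X + (\<Sum>s\<leftarrow>ts. least_bound R s))) (Fun f ts)"
  using assms
proof (induction "\<Sum>s\<leftarrow>ts. least_bound R s" arbitrary: ts rule: less_induct)
  case less
  show ?case
  proof (rule bounded_by_SucI)
    have "(\<Sum>s\<leftarrow>ts. tsize s) \<le> (\<Sum>s\<leftarrow>ts. least_bound R s)"
      using less.prems(1) tsize_least_bound by (intro sum_list_mono) auto
    then show "tsize (Fun f ts) \<le> Suc (X + (\<Sum>s\<leftarrow>ts. least_bound R s))" by simp
  next
    fix t' assume "(Fun f ts, t') \<in> rstep R"
    then show "bounded_by R (X + (\<Sum>s\<leftarrow>ts. least_bound R s)) t'"
    proof (cases rule: rstep_cases)
      case (1 l r \<sigma>)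
      then have "bounded_by R X t'" using less.prems(2)[of "Fun f ts"] by simp
      then show ?thesis by (rule bounded_by_mono) simp
    next
      case 2
      then obtain ss s u us where *: "ts = ss @ s # us" "t' = Fun f (ss @ u # us)" "(s, u) \<in> rstep R"
        unfolding argstep_def by blast
      let ?ts = "ss @ u # us"
      have lt: "least_bound R u < least_bound R s" "sn R u"
        using least_bound_step[of R s u] less.prems(1) * by auto
      then have sum: "(\<Sum>s\<leftarrow>?ts. least_bound R s) < (\<Sum>s\<leftarrow>ts. least_bound R s)"
        using * by simp
      have "bounded_by R (Suc (X + (\<Sum>s\<leftarrow>?ts. least_bound R s))) (Fun f ?ts)"
      proof (rule less.hyps)
        show "(\<Sum>s\<leftarrow>?ts. least_bound R s) < (\<Sum>s\<leftarrow>ts. least_bound R s)" by (rule sum)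
        show "\<forall>s\<in>set ?ts. sn R s" using less.prems(1) * lt by auto
        fix t'' l r \<sigma> assume **: "(Fun f ?ts, t'') \<in> (argstep R)\<^sup>*" "(l, r) \<in> R" "t'' = subst l \<sigma>"
        then have "(Fun f ts, t'') \<in> (argstep R)\<^sup>*"
          using 2 *(2) converse_rtrancl_into_rtrancl by metis
        then show "bounded_by R X (subst r \<sigma>)" using less.prems(2) ** by blast
      qed
      then show ?thesis using * sum by (auto elim: bounded_by_mono)
    qed
  qed
qed

lemma bounded_by_dh: "bounded_by R n t \<Longrightarrow> dh t (rstep R) \<le> enat n"
  unfolding dh_def bounded_by_def by (force intro: SUP_least)

subsection \<open>Dependency pair steps\<close>

lemma plain_inj: "plain s = plain t \<longleftrightarrow> s = t"
proof
  show "s = t" if "plain s = plain t"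
    using that trm.inj_map_strong[of s t Plain Plain] by blast
qed simp

lemma sharp_inj: "sharp s = sharp t \<longleftrightarrow> s = t"
proof
  show "s = t" if "sharp s = sharp t"
    using that by (cases s; cases t) (auto simp: plain_inj inj_on_def dest: map_injective)
qed simp

lemma plain_subst: "plain (subst t \<sigma>) = subst (plain t) (\<lambda>x. plain (\<sigma> x))"
  by (induction t) auto

lemma sharp_subst: "\<forall>x. t \<noteq> Var x \<Longrightarrow> sharp (subst t \<sigma>) = subst (sharp t) (\<lambda>x. plain (\<sigma> x))"
  by (cases t) (auto simp: plain_subst)

lemma vars_plain [simp]: "vars (plain t) = vars t"
  by (induction t) auto

lemma vars_sharp [simp]: "vars (sharp t) = vars t"
  by (cases t) auto

lemma supteq_plain: "supteq (plain s) (plain t) \<longleftrightarrow> supteq s t"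
proof (induction s)
  case (Var x)
  have "plain t = Var x \<longleftrightarrow> t = Var x" by (cases t) auto
  then show ?case by (simp add: supteq_def)
next
  case (Fun f ts)
  have "plain t = plain (Fun f ts) \<longleftrightarrow> t = Fun f ts" by (rule plain_inj)
  then show ?case using Fun by (auto simp: supteq_Fun)
qed

lemma supt_plain: "supt (plain s) (plain t) \<longleftrightarrow> supt s t"
  by (simp add: supt_def supteq_plain plain_inj)

lemma supt_subst: "supt s t \<Longrightarrow> supt (subst s \<sigma>) (subst t \<sigma>)"
proof (cases s)
  case (Fun f ts)
  assume "supt s t"
  then obtain u where "u \<in> set ts" "supteq u t" using Fun by (auto simp: supt_Fun)
  then show ?thesis using Fun supteq_subst[of u t \<sigma>] by (auto simp: supt_Fun)
qed (auto simp: supt_def supteq_def)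

lemma plain_terms: "t \<in> terms F \<Longrightarrow> plain t \<in> terms (sharp_sig F R)"
  by (induction t) (auto simp: Fun_in_terms sharp_sig_def)

lemma rstep_mono: "R \<subseteq> S \<Longrightarrow> rstep R \<subseteq> rstep S"
proof
  fix p assume "R \<subseteq> S" "p \<in> rstep R"
  then show "p \<in> rstep S"
  proof (cases p)
    case (Pair s t)
    with \<open>p \<in> rstep R\<close> have "(s, t) \<in> rstep R" by simp
    then have "(s, t) \<in> rstep S"
      by (induction rule: rstep.induct) (use \<open>R \<subseteq> S\<close> in \<open>auto intro: rstep.intros\<close>)
    then show ?thesis using Pair by simp
  qed
qed

lemma plain_rstep: "(s, t) \<in> rstep R \<Longrightarrow> (plain s, plain t) \<in> rstep (plain_rules R)"
proof (induction rule: rstep.induct)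
  case (root l r \<sigma>)
  then have "(plain l, plain r) \<in> plain_rules R" by (force simp: plain_rules_def)
  then show ?case unfolding plain_subst by (rule rstep.root)
next
  case (arg s t f ss us)
  then show ?case by (simp add: rstep.arg)
qed

lemma argstep_sharp: "(s, t) \<in> argstep R \<Longrightarrow> (sharp s, sharp t) \<in> rstep (plain_rules R)"
proof -
  assume "(s, t) \<in> argstep R"
  then obtain f ss u v us where "s = Fun f (ss @ u # us)" "t = Fun f (ss @ v # us)" "(u, v) \<in> rstep R"
    unfolding argstep_def by blast
  then show ?thesis using rstep.arg[OF plain_rstep[of u v R]] by simp
qed

text \<open>Stated on unmarked terms, so that the bounds with respect to \<open>R\<close> apply to
  both sides directly; the marks occur only in the pair.\<close>

definition dpstep :: "'f dprule set \<Rightarrow> 'f trm rel" where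
  "dpstep P = {(subst l \<sigma>, subst u \<sigma>) | l u \<sigma>. (sharp l, sharp u) \<in> P}"

lemma dpstep_Un: "dpstep (P \<union> Q) = dpstep P \<union> dpstep Q"
  unfolding dpstep_def by blast

lemma dpstep_mono: "P \<subseteq> Q \<Longrightarrow> dpstep P \<subseteq> dpstep Q"
  by (auto simp: dpstep_def)

lemma dpstep_single: "(s, t) \<in> dpstep P \<longleftrightarrow> (\<exists>p\<in>P. (s, t) \<in> dpstep {p})"
  by (auto simp: dpstep_def)

lemma sharp_DP_iff:
  "(sharp l, sharp u) \<in> DP R \<longleftrightarrow> (\<exists>r. (l, r) \<in> R \<and> supteq r u \<and> \<not> supt l u) \<and>
    (\<exists>f ts. u = Fun f ts \<and> (f, length ts) \<in> defined_syms R)"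
  unfolding DP_def by (auto simp: sharp_inj)

lemma DP_sharp:
  assumes "p \<in> DP R"
  obtains l u where "p = (sharp l, sharp u)"
  using assms unfolding DP_def by blast

lemma DP_vars:
  assumes "trs F R" "(sharp l, sharp u) \<in> DP R"
  shows "vars u \<subseteq> vars l" "\<forall>x. l \<noteq> Var x" "\<forall>x. u \<noteq> Var x" "u \<in> terms F"
proof -
  obtain r f ts where r: "(l, r) \<in> R" "supteq r u" and u: "u = Fun f ts"
    using assms(2) unfolding sharp_DP_iff by blast
  have "\<forall>x. l \<noteq> Var x" "vars r \<subseteq> vars l" "r \<in> terms F" using assms(1) r(1) by (auto simp: trs_def)
  then show "vars u \<subseteq> vars l" "\<forall>x. l \<noteq> Var x" "u \<in> terms F"
    using supteq_vars[OF r(2)] supteq_terms[OF r(2)] by auto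
  show "\<forall>x. u \<noteq> Var x" using u by simp
qed

lemma dpstep_sharp:
  assumes "trs F R" "P \<subseteq> DP R" "(s, t) \<in> dpstep P"
  shows "(sharp s, sharp t) \<in> rstep P"
proof -
  obtain l u \<sigma> where *: "s = subst l \<sigma>" "t = subst u \<sigma>" "(sharp l, sharp u) \<in> P"
    using assms(3) unfolding dpstep_def by blast
  have "(sharp l, sharp u) \<in> DP R" using * assms(2) by blast
  note DP_vars[OF assms(1) this]
  then show ?thesis using * by (simp add: sharp_subst rstep.root)
qed

lemma dpstep_terms:
  assumes "trs F R" "P \<subseteq> DP R" "(s, t) \<in> dpstep P" "s \<in> terms F"
  shows "t \<in> terms F"
proof -
  obtain l u \<sigma> where *: "s = subst l \<sigma>" "t = subst u \<sigma>" "(sharp l, sharp u) \<in> P"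
    using assms(3) unfolding dpstep_def by blast
  have "(sharp l, sharp u) \<in> DP R" using * assms(2) by blast
  note vs = DP_vars[OF assms(1) this]
  have "\<sigma> x \<in> terms F" if "x \<in> vars u" for x
    using supteq_terms[OF supteq_subst_var[of x l \<sigma>]] that vs(1) * assms(4) by blast
  then show ?thesis using vs(4) * by (auto intro: subst_terms)
qed

lemma dh_le_iff: "dh s r \<le> enat n \<longleftrightarrow> (\<forall>k t. (s, t) \<in> r ^^ k \<longrightarrow> k \<le> n)"
  unfolding dh_def by (auto simp: SUP_le_iff)

text \<open>The numeric value of \<open>dh\<close>. It is meaningful only if \<open>dh\<close> is
  finite, which the facts below assume through some bound \<open>n\<close>.\<close>

definition dhn :: "'a \<Rightarrow> 'a rel \<Rightarrow> nat" where
  "dhn s r = (LEAST n. dh s r \<le> enat n)"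

lemma dhn_le: "dh s r \<le> enat n \<Longrightarrow> dhn s r \<le> n"
  unfolding dhn_def by (rule Least_le)

lemma dh_dhn: "dh s r \<le> enat n \<Longrightarrow> dh s r \<le> enat (dhn s r)"
  unfolding dhn_def by (rule LeastI)

lemma dhn_step:
  assumes "dh s r \<le> enat n" "(s, t) \<in> r"
  shows "dhn t r < dhn s r"
proof -
  have *: "k \<le> dhn s r" if "(s, u) \<in> r ^^ k" for k u
    using dh_dhn[OF assms(1)] that unfolding dh_le_iff by blast
  have s: "Suc k \<le> dhn s r" if "(t, u) \<in> r ^^ k" for k u
    using *[of u "Suc k"] assms(2) that by (meson relpow_Suc_I2)
  have "0 < dhn s r" using s[of t 0] by simp
  then have "dh t r \<le> enat (dhn s r - 1)" unfolding dh_le_iff using s by fastforce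
  then have "dhn t r \<le> dhn s r - 1" by (rule dhn_le)
  then show ?thesis using \<open>0 < dhn s r\<close> by simp
qed

text \<open>A nonempty relative derivation begins with arbitrarily many \<open>S\<close> steps, so
  one more can be put in front without changing its length.\<close>

lemma dhn_weak:
  assumes "dh s (rel_rstep P S) \<le> enat n" "(s, t) \<in> rstep S"
  shows "dhn t (rel_rstep P S) \<le> dhn s (rel_rstep P S)"
proof (rule dhn_le)
  have *: "k \<le> dhn s (rel_rstep P S)" if "(s, u) \<in> rel_rstep P S ^^ k" for k u
    using dh_dhn[OF assms(1)] that unfolding dh_le_iff by blast
  have "k \<le> dhn s (rel_rstep P S)" if "(t, u) \<in> rel_rstep P S ^^ k" for k u
  proof (cases k)
    case (Suc k')
    then obtain v where v: "(t, v) \<in> rel_rstep P S" "(v, u) \<in> rel_rstep P S ^^ k'"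
      using \<open>(t, u) \<in> rel_rstep P S ^^ k\<close> by (meson relpow_Suc_D2)
    have "(s, v) \<in> rel_rstep P S"
      using v(1) assms(2) unfolding rel_rstep_def by (auto intro: converse_rtrancl_into_rtrancl)
    then show ?thesis using *[of u k] v(2) Suc by (meson relpow_Suc_I2)
  qed simp
  then show "dh t (rel_rstep P S) \<le> enat (dhn s (rel_rstep P S))" unfolding dh_le_iff by blast
qed

lemma rel_rstepI: "(s, t) \<in> rstep P \<Longrightarrow> (s, t) \<in> rel_rstep P S"
  unfolding rel_rstep_def by blast

section \<open>Reachable pairs and strongly connected components\<close>

lemma dg_scc:
  assumes "p \<in> P" "(p, p) \<in> E\<^sup>+"
  defines "C \<equiv> {q \<in> P. (p, q) \<in> E\<^sup>* \<and> (q, p) \<in> E\<^sup>*}"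
  shows "C \<in> sccs P E" "\<not> trivial_scc E C"
proof -
  have p: "p \<in> C" unfolding C_def using assms(1) by simp
  have "connected_nodes E C"
    unfolding connected_nodes_def C_def by (auto intro: rtrancl_trans)
  moreover have "\<not> connected_nodes E D" if "C \<subset> D" "D \<subseteq> P" for D
  proof
    assume "connected_nodes E D"
    then have "D \<subseteq> C" using p that unfolding connected_nodes_def C_def by blast
    then show False using that by blast
  qed
  ultimately show "C \<in> sccs P E" unfolding sccs_def using p C_def by blast
  show "\<not> trivial_scc E C" using p assms(2) unfolding trivial_scc_def by blast
qed

text \<open>A term does not determine the pair that produced it, so a position in the dependency
  graph cannot be read off it. The set of pairs that can still fire is a function of the term, and
  it only shrinks along steps.\<close>

definition reach :: "'f rule set \<Rightarrow> 'f dprule set \<Rightarrow> 'f trm \<Rightarrow> 'f dprule set" where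
  "reach R P t = {q \<in> P. \<exists>u. (t, u) \<in> (argstep R \<union> dpstep P)\<^sup>* \<and> u \<in> Domain (dpstep {q})}"

lemma reach_antimono: "(s, t) \<in> argstep R \<union> dpstep P \<Longrightarrow> reach R P t \<subseteq> reach R P s"
  unfolding reach_def using converse_rtrancl_into_rtrancl[of s t "argstep R \<union> dpstep P"] by blast

lemma reach_self: "(s, t) \<in> dpstep {p} \<Longrightarrow> p \<in> P \<Longrightarrow> p \<in> reach R P s"
  unfolding reach_def by blast

text \<open>The first half of a dependency graph edge leaving \<open>p\<close>: it survives steps
  below the root and becomes an edge as soon as a pair applies to \<open>t\<close>.\<close>

definition follows :: "('f \<times> nat) set \<Rightarrow> 'f rule set \<Rightarrow> 'f dprule \<Rightarrow> 'f trm \<Rightarrow> bool" where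
  "follows F R p t \<longleftrightarrow> (\<exists>\<sigma>. range \<sigma> \<subseteq> terms (sharp_sig F R) \<and>
     (subst (snd p) \<sigma>, sharp t) \<in> (rstep (plain_rules R))\<^sup>*)"

lemma sharp_instance:
  assumes "subst l \<sigma> \<in> terms F" "vars u \<subseteq> vars l" "\<forall>x. u \<noteq> Var x"
  shows "\<exists>\<tau>. range \<tau> \<subseteq> terms (sharp_sig F R) \<and> subst (sharp u) \<tau> = sharp (subst u \<sigma>)"
proof (intro exI conjI)
  \<comment> \<open>\<open>\<sigma>\<close> is known to yield terms over the signature only on the
    variables of \<open>l\<close>; elsewhere it is replaced by variables, because graph edges ask
    this of the whole range.\<close>
  let ?\<tau> = "\<lambda>x. if x \<in> vars l then plain (\<sigma> x) else Var x"
  have "\<sigma> x \<in> terms F" if "x \<in> vars l" for x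
    using supteq_terms[OF supteq_subst_var[OF that] assms(1)] .
  then show "range ?\<tau> \<subseteq> terms (sharp_sig F R)" by (auto intro: plain_terms)
  show "subst (sharp u) ?\<tau> = sharp (subst u \<sigma>)"
    unfolding sharp_subst[OF assms(3)] using assms(2) by (intro subst_cong) auto
qed

lemma dpstep_follows:
  assumes "trs F R" "p \<in> DP R" "(s, t) \<in> dpstep {p}" "s \<in> terms F"
  shows "follows F R p t"
proof -
  obtain l u \<sigma> where *: "s = subst l \<sigma>" "t = subst u \<sigma>" "p = (sharp l, sharp u)"
    using assms(3) unfolding dpstep_def by blast
  have "(sharp l, sharp u) \<in> DP R" using assms(2) * by simp
  note vs = DP_vars[OF assms(1) this]
  obtain \<tau> where "range \<tau> \<subseteq> terms (sharp_sig F R)" "subst (sharp u) \<tau> = sharp (subst u \<sigma>)"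
    using sharp_instance[of l \<sigma> F u] vs * assms(4) by blast
  then show ?thesis unfolding follows_def using * by (intro exI[of _ \<tau>]) simp
qed

lemma follows_edge:
  assumes "trs F R" "P \<subseteq> DP R" "p \<in> P" "q \<in> P" "follows F R p t" "t \<in> terms F"
    "t \<in> Domain (dpstep {q})"
  shows "(p, q) \<in> dg_edges F P R"
proof -
  obtain l u \<sigma> where *: "t = subst l \<sigma>" "q = (sharp l, sharp u)"
    using assms(7) unfolding dpstep_def by blast
  have "(sharp l, sharp u) \<in> DP R" using assms(2,4) * by blast
  note vs = DP_vars[OF assms(1) this]
  obtain \<tau> where "range \<tau> \<subseteq> terms (sharp_sig F R)" "subst (sharp l) \<tau> = sharp t"
    using sharp_instance[of l \<sigma> F l] vs(2) *(1) assms(6) by blast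
  moreover obtain \<rho> where "range \<rho> \<subseteq> terms (sharp_sig F R)"
    "(subst (snd p) \<rho>, sharp t) \<in> (rstep (plain_rules R))\<^sup>*"
    using assms(5) unfolding follows_def by blast
  moreover obtain p1 p2 where "p = (p1, p2)" by (cases p)
  ultimately show ?thesis unfolding dg_edges_def using *(2) assms(3,4)
    by (intro CollectI exI[of _ p1] exI[of _ p2] exI[of _ "sharp l"] exI[of _ "sharp u"] conjI
        exI[of _ \<rho>] exI[of _ \<tau>]) simp_all
qed

text \<open>Induction on the derivation with \<open>p\<close> arbitrary: a pair step replaces the
  pair being followed and contributes one edge.\<close>

lemma reach_path:
  assumes "trs F R" "P \<subseteq> DP R" "p \<in> P" "q \<in> P" "follows F R p t" "t \<in> terms F"
    "(t, u) \<in> (argstep R \<union> dpstep P)\<^sup>*" "u \<in> Domain (dpstep {q})"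
  shows "(p, q) \<in> (dg_edges F P R)\<^sup>+"
  using assms(7,3,5,6)
proof (induction arbitrary: p rule: converse_rtrancl_induct)
  case base
  from follows_edge[OF assms(1,2) base.prems(1) assms(4) base.prems(2,3) assms(8)]
  show ?case by (rule r_into_trancl)
next
  case (step s t)
  from step(1) show ?case
  proof
    assume st: "(s, t) \<in> argstep R"
    have "follows F R p t"
      using step.prems(2) argstep_sharp[OF st] unfolding follows_def
      by (meson rtrancl.rtrancl_into_rtrancl)
    moreover have "t \<in> terms F"
      using rstep_terms[OF assms(1) subsetD[OF argstep_rstep st] step.prems(3)] .
    ultimately show ?thesis by (rule step.IH[OF step.prems(1)])
  next
    assume st: "(s, t) \<in> dpstep P"
    then obtain p' where p': "p' \<in> P" "(s, t) \<in> dpstep {p'}"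
      unfolding dpstep_single[of s t P] by blast
    have "follows F R p' t"
      using dpstep_follows[OF assms(1) subsetD[OF assms(2) p'(1)] p'(2) step.prems(3)] .
    moreover have "t \<in> terms F" using dpstep_terms[OF assms(1,2) st step.prems(3)] .
    ultimately have "(p', q) \<in> (dg_edges F P R)\<^sup>+" by (rule step.IH[OF p'(1)])
    moreover have "(p, p') \<in> dg_edges F P R"
      by (rule follows_edge[OF assms(1,2) step.prems(1) p'(1) step.prems(2,3)]) (use p' in blast)
    ultimately show ?thesis by (rule trancl_into_trancl2[rotated])
  qed
qed

lemma dpstep_reach_path:
  assumes "trs F R" "P \<subseteq> DP R" "p \<in> P" "(s, t) \<in> dpstep {p}" "s \<in> terms F" "q \<in> reach R P t"
  shows "(p, q) \<in> (dg_edges F P R)\<^sup>+"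
proof -
  have "(s, t) \<in> dpstep P" using assms(3,4) unfolding dpstep_single[of s t P] by blast
  from dpstep_terms[OF assms(1,2) this assms(5)] have t: "t \<in> terms F" .
  have f: "follows F R p t" using dpstep_follows[OF assms(1) subsetD[OF assms(2,3)] assms(4,5)] .
  obtain u where "q \<in> P" "(t, u) \<in> (argstep R \<union> dpstep P)\<^sup>*" "u \<in> Domain (dpstep {q})"
    using assms(6) unfolding reach_def by blast
  then show ?thesis using reach_path[OF assms(1,2,3) _ f t] by blast
qed

subsection \<open>Lexicographic ranks from proof trees\<close>

definition arg_sum :: "'f rule set \<Rightarrow> 'f trm \<Rightarrow> nat" where
  "arg_sum R t = (case t of Var x \<Rightarrow> 0 | Fun f ts \<Rightarrow> (\<Sum>s\<leftarrow>ts. least_bound R s))"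

definition args_sn :: "('f \<times> nat) set \<Rightarrow> 'f rule set \<Rightarrow> 'f trm \<Rightarrow> bool" where
  "args_sn F R t \<longleftrightarrow> t \<in> terms F \<and> (\<exists>f ts. t = Fun f ts \<and> (\<forall>s\<in>set ts. sn R s))"

definition lexle :: "nat list \<Rightarrow> nat list \<Rightarrow> bool" where
  "lexle xs ys \<longleftrightarrow> xs = ys \<or> (xs, ys) \<in> lex less_than"

text \<open>\<open>A\<close> holds the pair steps that have to decrease. This is demanded only if
  both sides have terminating arguments, since the arguments of a called subterm may contain further
  calls that have to be bounded first. The common length \<open>d\<close> lets all ranks serve as
  indices of one arity.\<close>

definition rank :: "('f \<times> nat) set \<Rightarrow> 'f rule set \<Rightarrow> ('f trm \<Rightarrow> nat) \<Rightarrow> 'f trm rel \<Rightarrow> nat \<Rightarrow>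
    ('f trm \<Rightarrow> nat list) \<Rightarrow> bool" where
  "rank F R B A d rk \<longleftrightarrow> (\<forall>t. length (rk t) = d) \<and>
     (\<forall>s t. args_sn F R s \<longrightarrow> (s, t) \<in> argstep R \<longrightarrow> lexle (rk t) (rk s)) \<and>
     (\<forall>s t. args_sn F R s \<longrightarrow> args_sn F R t \<longrightarrow> (s, t) \<in> A \<longrightarrow> (rk t, rk s) \<in> lex less_than) \<and>
     (\<forall>t. args_sn F R t \<longrightarrow> (\<forall>v\<in>set (rk t). v \<le> B t))"

lemma rank_Cons:
  assumes "\<And>t. length (rk t) = d"
    and "\<And>s t. args_sn F R s \<Longrightarrow> (s, t) \<in> argstep R \<Longrightarrow> w t < w s \<or> w t = w s \<and> lexle (rk t) (rk s)"
    and "\<And>s t. args_sn F R s \<Longrightarrow> args_sn F R t \<Longrightarrow> (s, t) \<in> A \<Longrightarrow>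
      w t < w s \<or> w t = w s \<and> (rk t, rk s) \<in> lex less_than"
    and "\<And>t. args_sn F R t \<Longrightarrow> w t \<le> B t"
    and "\<And>t v. args_sn F R t \<Longrightarrow> v \<in> set (rk t) \<Longrightarrow> v \<le> B t"
  shows "rank F R B A (Suc d) (\<lambda>t. w t # rk t)"
  unfolding rank_def
proof (intro conjI allI impI ballI)
  show "length (w t # rk t) = Suc d" for t using assms(1) by simp
  show "lexle (w t # rk t) (w s # rk s)" if "args_sn F R s" "(s, t) \<in> argstep R" for s t
    using assms(2)[OF that] assms(1) by (auto simp: lexle_def)
  show "(w t # rk t, w s # rk s) \<in> lex less_than"
    if "args_sn F R s" "args_sn F R t" "(s, t) \<in> A" for s t
    using assms(3)[OF that] assms(1) by auto
  show "v \<le> B t" if "args_sn F R t" "v \<in> set (w t # rk t)" for t v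
    using that assms(4,5) by auto
qed

lemma rank_antimono: "rank F R B A d rk \<Longrightarrow> A' \<subseteq> A \<Longrightarrow> rank F R B A' d rk"
  unfolding rank_def by blast

text \<open>The new leading entry handles the steps in \<open>S\<close>; those in \<open>Q\<close>
  do not increase it and descend in the given rank.\<close>

lemma rank_Cons_two:
  assumes "rank F R B Q d rk" "A \<subseteq> S \<union> Q"
    and "\<And>s t. args_sn F R s \<Longrightarrow> (s, t) \<in> argstep R \<Longrightarrow> w t \<le> w s"
    and "\<And>s t. args_sn F R s \<Longrightarrow> (s, t) \<in> Q \<Longrightarrow> w t \<le> w s"
    and "\<And>s t. args_sn F R s \<Longrightarrow> (s, t) \<in> S \<Longrightarrow> w t < w s"
    and "\<And>t. args_sn F R t \<Longrightarrow> w t \<le> B t"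
  shows "rank F R B A (Suc d) (\<lambda>t. w t # rk t)"
proof (rule rank_Cons)
  show "length (rk t) = d" for t using assms(1) unfolding rank_def by blast
  show "w t < w s \<or> w t = w s \<and> lexle (rk t) (rk s)" if "args_sn F R s" "(s, t) \<in> argstep R" for s t
  proof -
    have "lexle (rk t) (rk s)" using assms(1) that unfolding rank_def by blast
    then show ?thesis using assms(3)[OF that] by auto
  qed
  show "w t < w s \<or> w t = w s \<and> (rk t, rk s) \<in> lex less_than"
    if "args_sn F R s" "args_sn F R t" "(s, t) \<in> A" for s t
  proof (cases "(s, t) \<in> S")
    case True
    then show ?thesis using assms(5) that by simp
  next
    case False
    then have st: "(s, t) \<in> Q" using assms(2) that by blast
    then have "(rk t, rk s) \<in> lex less_than" using assms(1) that unfolding rank_def by blast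
    then show ?thesis using assms(4)[OF that(1) st] by auto
  qed
  show "w t \<le> B t" if "args_sn F R t" for t using assms(6) that .
  show "v \<le> B t" if "args_sn F R t" "v \<in> set (rk t)" for t v
    using assms(1) that unfolding rank_def by blast
qed

text \<open>Where no pair step is left, the length is arbitrary; this is the slack from which ranks
  of equal length are obtained.\<close>

lemma rank_zeros: "rank F R B {} d (\<lambda>t. replicate d 0)"
  unfolding rank_def lexle_def by simp

lemma dpstep_empty: "dpstep {} = {}"
  unfolding dpstep_def by simp

lemma args_sn_terms: "args_sn F R t \<Longrightarrow> t \<in> terms F"
  unfolding args_sn_def by blast

text \<open>The entries after the count may be chosen separately for each set \<open>S\<close> of
  reachable pairs: these sets only shrink, so an unchanged count means an unchanged
  \<open>S\<close>.\<close>

lemma rank_dependency_graph: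
  assumes trs: "trs F R" and PD: "P \<subseteq> DP R" and fin: "finite P"
    and B: "\<And>t. card P \<le> B t"
    and scc: "\<And>C. C \<in> sccs P (dg_edges F P R) \<Longrightarrow> \<not> trivial_scc (dg_edges F P R) C \<Longrightarrow>
      \<exists>rk. rank F R B (dpstep C) d rk"
  shows "\<exists>rk. rank F R B (dpstep P) (Suc d) rk"
proof -
  let ?E = "dg_edges F P R" and ?r = "reach R P"
  have "\<exists>rk. rank F R B {(s, t) \<in> dpstep P. s \<in> terms F \<and> ?r s = S \<and> ?r t = S} d rk" for S
  proof (cases "\<exists>p\<in>P. \<exists>s t. s \<in> terms F \<and> (s, t) \<in> dpstep {p} \<and> ?r s = S \<and> ?r t = S")
    case True
    then obtain p s t where p: "p \<in> P" "s \<in> terms F" "(s, t) \<in> dpstep {p}" "?r s = S" "?r t = S"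
      by blast
    \<comment> \<open>A pair that fires is reachable beforehand, and \<open>S\<close> is the same
      afterwards. So \<open>p\<close> is reachable again after its own step and lies on a
      cycle.\<close>
    have pS: "p \<in> S" using reach_self[OF p(3,1)] p(4) by blast
    have pp: "(p, p) \<in> ?E\<^sup>+" by (rule dpstep_reach_path[OF trs PD p(1,3,2)]) (use pS p(5) in blast)
    define C where "C = {q \<in> P. (p, q) \<in> ?E\<^sup>* \<and> (q, p) \<in> ?E\<^sup>*}"
    have "\<exists>rk. rank F R B (dpstep C) d rk"
      unfolding C_def using scc dg_scc[OF p(1) pp] by blast
    then obtain rk where "rank F R B (dpstep C) d rk" by blast
    moreover have "{(s, t) \<in> dpstep P. s \<in> terms F \<and> ?r s = S \<and> ?r t = S} \<subseteq> dpstep C"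
    proof clarify
      fix s' t' assume *: "(s', t') \<in> dpstep P" "s' \<in> terms F" "S = ?r s'" "?r t' = ?r s'"
      obtain q where q: "q \<in> P" "(s', t') \<in> dpstep {q}" using *(1) unfolding dpstep_single[of _ _ P] by blast
      \<comment> \<open>\<open>q\<close> belongs to \<open>S\<close> for the same reason, hence it
        is reachable after the step by \<open>p\<close>, and conversely.\<close>
      have "(p, q) \<in> ?E\<^sup>+"
        by (rule dpstep_reach_path[OF trs PD p(1,3,2)]) (use reach_self[OF q(2,1)] * p(5) in blast)
      moreover have "(q, p) \<in> ?E\<^sup>+"
        by (rule dpstep_reach_path[OF trs PD q *(2)]) (use pS * in blast)
      ultimately have "q \<in> C" unfolding C_def using q(1) by (blast intro: trancl_into_rtrancl)
      then show "(s', t') \<in> dpstep C" using q(2) unfolding dpstep_single[of _ _ C] by blast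
    qed
    ultimately show ?thesis using rank_antimono by blast
  next
    case False
    have "(s, t) \<notin> {(s, t) \<in> dpstep P. s \<in> terms F \<and> ?r s = S \<and> ?r t = S}" for s t
      using False unfolding mem_Collect_eq prod.case dpstep_single[of s t P] by blast
    then have *: "{(s, t) \<in> dpstep P. s \<in> terms F \<and> ?r s = S \<and> ?r t = S} = {}" by auto
    show ?thesis unfolding * using rank_zeros by blast
  qed
  then have "\<forall>S. \<exists>rk. rank F R B {(s, t) \<in> dpstep P. s \<in> terms F \<and> ?r s = S \<and> ?r t = S} d rk"
    by (rule allI)
  from choice[OF this] obtain rk where
    rk: "\<And>S. rank F R B {(s, t) \<in> dpstep P. s \<in> terms F \<and> ?r s = S \<and> ?r t = S} d (rk S)"
    by (rule exE) (rule that, erule spec)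
  have finr: "finite (?r t)" for t using fin unfolding reach_def by simp
  have card: "card (?r t) < card (?r s) \<or> ?r t = ?r s" if "(s, t) \<in> argstep R \<union> dpstep P" for s t
  proof (cases "?r t = ?r s")
    case False
    then have "?r t \<subset> ?r s" using reach_antimono[OF that] by blast
    then show ?thesis using psubset_card_mono[OF finr[of s]] by simp
  qed simp
  have "rank F R B (dpstep P) (Suc d) (\<lambda>t. card (?r t) # rk (?r t) t)"
  proof (rule rank_Cons)
    show "length (rk (?r t) t) = d" for t using rk[of "?r t"] unfolding rank_def by blast
    show "card (?r t) < card (?r s) \<or> card (?r t) = card (?r s) \<and> lexle (rk (?r t) t) (rk (?r s) s)"
      if "args_sn F R s" "(s, t) \<in> argstep R" for s t
    proof (cases "?r t = ?r s")
      case True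
      have "lexle (rk (?r s) t) (rk (?r s) s)" using rk[of "?r s"] that unfolding rank_def by blast
      then show ?thesis using True by simp
    next
      case False
      then show ?thesis using card[of s t] that by blast
    qed
    show "card (?r t) < card (?r s) \<or>
        card (?r t) = card (?r s) \<and> (rk (?r t) t, rk (?r s) s) \<in> lex less_than"
      if "args_sn F R s" "args_sn F R t" "(s, t) \<in> dpstep P" for s t
    proof (cases "?r t = ?r s")
      case True
      have "(rk (?r s) t, rk (?r s) s) \<in> lex less_than"
        using rk[of "?r s"] that True args_sn_terms[OF that(1)] unfolding rank_def by blast
      then show ?thesis using True by simp
    next
      case False
      then show ?thesis using card[of s t] that by blast
    qed
    show "card (?r t) \<le> B t" for t
      using B[of t] card_mono[OF fin, of "?r t"] unfolding reach_def by fastforce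
    show "v \<le> B t" if "args_sn F R t" "v \<in> set (rk (?r t) t)" for t v
      using rk[of "?r t"] that unfolding rank_def by blast
  qed
  then show ?thesis by blast
qed

text \<open>Argument steps and steps by \<open>Q\<close> belong to the relative part and cannot
  increase the height, whereas a step by \<open>P - Q\<close> consumes one unit. With
  \<open>Q = P\<close> this also covers a processor that fails.\<close>

lemma rank_reduction_pair:
  assumes trs: "trs F R" and PD: "P \<subseteq> DP R" "Q \<subseteq> DP R"
    and rk: "rank F R B (dpstep Q) d rk"
    and dh: "\<And>t. t \<in> terms F \<Longrightarrow> dh (sharp t) (rel_rstep (P - Q) (plain_rules R \<union> Q)) \<le> enat (B t)"
  shows "\<exists>rk. rank F R B (dpstep P) (Suc d) rk"
proof -
  let ?r = "rel_rstep (P - Q) (plain_rules R \<union> Q)"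
  let ?w = "\<lambda>t. dhn (sharp t) ?r"
  have weak: "?w t \<le> ?w s" if "args_sn F R s" "(sharp s, sharp t) \<in> rstep (plain_rules R \<union> Q)" for s t
    by (rule dhn_weak[OF dh[OF args_sn_terms[OF that(1)]] that(2)])
  have "rank F R B (dpstep P) (Suc d) (\<lambda>t. ?w t # rk t)"
  proof (rule rank_Cons_two[OF rk, where S = "dpstep (P - Q)"])
    show "dpstep P \<subseteq> dpstep (P - Q) \<union> dpstep Q"
      unfolding dpstep_Un[symmetric] by (rule dpstep_mono) blast
    show "?w t \<le> ?w s" if "args_sn F R s" "(s, t) \<in> argstep R" for s t
      using weak[OF that(1)] argstep_sharp[OF that(2)] rstep_mono[of "plain_rules R" "plain_rules R \<union> Q"]
      by blast
    show "?w t \<le> ?w s" if "args_sn F R s" "(s, t) \<in> dpstep Q" for s t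
      using weak[OF that(1)] dpstep_sharp[OF trs PD(2) that(2)] rstep_mono[of Q "plain_rules R \<union> Q"]
      by blast
    show "?w t < ?w s" if "args_sn F R s" "(s, t) \<in> dpstep (P - Q)" for s t
    proof (rule dhn_step[OF dh[OF args_sn_terms[OF that(1)]]], rule rel_rstepI)
      show "(sharp s, sharp t) \<in> rstep (P - Q)"
        by (rule dpstep_sharp[OF trs _ that(2)]) (use PD in blast)
    qed
    show "?w t \<le> B t" if "args_sn F R t" for t
      by (rule dhn_le[OF dh[OF args_sn_terms[OF that]]])
  qed
  then show ?thesis by blast
qed

text \<open>The default 0 makes the entry total. Whether a position is valid depends only on root
  symbol and arity, so steps below the root never switch between the cases.\<close>

definition proj_bound :: "'f rule set \<Rightarrow> ('f \<times> nat \<Rightarrow> nat) \<Rightarrow> 'f trm \<Rightarrow> nat" where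
  "proj_bound R \<pi> t = (case t of Var x \<Rightarrow> 0 | Fun f ts \<Rightarrow>
     if 1 \<le> \<pi> (f, length ts) \<and> \<pi> (f, length ts) \<le> length ts
     then least_bound R (ts ! (\<pi> (f, length ts) - 1)) else 0)"

lemma proj_bound_dpstep:
  assumes "simple_projection \<pi> P" "args_sn F R s" "(s, t) \<in> dpstep P"
  obtains l u where "(l, u) \<in> P"
    "supteq (proj \<pi> l) (proj \<pi> u) \<Longrightarrow> proj_bound R \<pi> t \<le> proj_bound R \<pi> s"
    "supt (proj \<pi> l) (proj \<pi> u) \<Longrightarrow> proj_bound R \<pi> t < proj_bound R \<pi> s"
proof -
  obtain l u \<sigma> where *: "s = subst l \<sigma>" "t = subst u \<sigma>" "(sharp l, sharp u) \<in> P"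
    using assms(3) unfolding dpstep_def by blast
  have valid: "\<exists>f ts. v = Fun (Sharp f) ts \<and> 1 \<le> \<pi> (f, length ts) \<and> \<pi> (f, length ts) \<le> length ts"
    if "v \<in> {sharp l, sharp u}" for v
    using assms(1) *(3) that unfolding simple_projection_def by blast
  obtain f ls where l: "l = Fun f ls" "1 \<le> \<pi> (f, length ls)" "\<pi> (f, length ls) \<le> length ls"
    using valid[of "sharp l"] by (cases l) auto
  obtain h us where u: "u = Fun h us" "1 \<le> \<pi> (h, length us)" "\<pi> (h, length us) \<le> length us"
    using valid[of "sharp u"] by (cases u) auto
  let ?i = "\<pi> (f, length ls) - 1" and ?j = "\<pi> (h, length us) - 1"
  have i: "?i < length ls" "?j < length us" using l u by auto
  have pl: "proj \<pi> (sharp l) = plain (ls ! ?i)" "proj \<pi> (sharp u) = plain (us ! ?j)"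
    using l u i by simp_all
  have pb: "proj_bound R \<pi> s = least_bound R (subst (ls ! ?i) \<sigma>)"
    "proj_bound R \<pi> t = least_bound R (subst (us ! ?j) \<sigma>)"
    using * l u i by (auto simp: proj_bound_def)
  have "subst (ls ! ?i) \<sigma> \<in> set (map (\<lambda>t. subst t \<sigma>) ls)" using i by simp
  then have sn: "sn R (subst (ls ! ?i) \<sigma>)"
    using assms(2) * l(1) unfolding args_sn_def by auto
  show ?thesis
  proof (rule that[OF *(3)])
    assume "supteq (proj \<pi> (sharp l)) (proj \<pi> (sharp u))"
    then have "supteq (ls ! ?i) (us ! ?j)" unfolding pl supteq_plain .
    then show "proj_bound R \<pi> t \<le> proj_bound R \<pi> s"
      unfolding pb by (intro least_bound_supteq[OF sn] supteq_subst)
  next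
    assume "supt (proj \<pi> (sharp l)) (proj \<pi> (sharp u))"
    then have "supt (ls ! ?i) (us ! ?j)" unfolding pl supt_plain .
    then show "proj_bound R \<pi> t < proj_bound R \<pi> s"
      unfolding pb by (intro least_bound_step[OF sn] disjI2 supt_subst)
  qed
qed

lemma proj_bound_argstep:
  assumes "args_sn F R s" "(s, t) \<in> argstep R"
  shows "proj_bound R \<pi> t \<le> proj_bound R \<pi> s"
proof -
  obtain f ss u v us where *: "s = Fun f (ss @ u # us)" "t = Fun f (ss @ v # us)" "(u, v) \<in> rstep R"
    using assms(2) unfolding argstep_def by blast
  have "least_bound R v < least_bound R u"
    using least_bound_step(2)[of R u v] assms(1) * unfolding args_sn_def by auto
  then show ?thesis using * by (auto simp: proj_bound_def nth_append nth_Cons split: nat.split)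
qed

lemma proj_bound_le_arg_sum: "proj_bound R \<pi> t \<le> arg_sum R t"
proof (cases t)
  case (Fun f ts)
  let ?i = "\<pi> (f, length ts) - 1"
  have "least_bound R (ts ! ?i) \<le> (\<Sum>s\<leftarrow>ts. least_bound R s)" if "?i < length ts"
    using member_le_sum_list[of "least_bound R (ts ! ?i)" "map (least_bound R) ts"] that by simp
  then show ?thesis using Fun by (auto simp: proj_bound_def arg_sum_def)
qed (simp add: proj_bound_def)

lemma rank_subterm_criterion:
  assumes \<pi>: "simple_projection \<pi> (P \<union> Q)"
    and weak: "\<forall>(s, t)\<in>Q. supteq (proj \<pi> s) (proj \<pi> t)"
    and strict: "\<forall>(s, t)\<in>P - Q. supt (proj \<pi> s) (proj \<pi> t)"
    and rk: "rank F R B (dpstep Q) d rk"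
    and B: "\<And>t. arg_sum R t \<le> B t"
  shows "\<exists>rk. rank F R B (dpstep P) (Suc d) rk"
proof -
  have \<pi>': "simple_projection \<pi> Q" "simple_projection \<pi> (P - Q)"
    using \<pi> unfolding simple_projection_def by blast+
  have "rank F R B (dpstep P) (Suc d) (\<lambda>t. proj_bound R \<pi> t # rk t)"
  proof (rule rank_Cons_two[OF rk, where S = "dpstep (P - Q)"])
    show "dpstep P \<subseteq> dpstep (P - Q) \<union> dpstep Q"
      unfolding dpstep_Un[symmetric] by (rule dpstep_mono) blast
    show "proj_bound R \<pi> t \<le> proj_bound R \<pi> s" if "args_sn F R s" "(s, t) \<in> argstep R" for s t
      using proj_bound_argstep that .
    show "proj_bound R \<pi> t \<le> proj_bound R \<pi> s" if "args_sn F R s" "(s, t) \<in> dpstep Q" for s t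
      by (rule proj_bound_dpstep[OF \<pi>'(1) that]) (use weak in blast)
    show "proj_bound R \<pi> t < proj_bound R \<pi> s" if "args_sn F R s" "(s, t) \<in> dpstep (P - Q)" for s t
      by (rule proj_bound_dpstep[OF \<pi>'(2) that]) (use strict in blast)
    show "proj_bound R \<pi> t \<le> B t" for t
      using proj_bound_le_arg_sum B le_trans by blast
  qed
  then show ?thesis by blast
qed

lemma supteq_finite: "finite {t. supteq s t}"
proof (induction s)
  case (Fun f ts)
  have "{t. supteq (Fun f ts) t} = insert (Fun f ts) (\<Union>s\<in>set ts. {t. supteq s t})"
    by (auto simp: supteq_Fun)
  then show ?case using Fun by simp
qed (simp add: supteq_def)

lemma finite_DP: "finite R \<Longrightarrow> finite (DP R)"
proof -
  assume "finite R"
  then have "finite (\<Union>(l, r)\<in>R. (\<lambda>u. (sharp l, sharp u)) ` {u. supteq r u})"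
    using supteq_finite by auto
  moreover have "DP R \<subseteq> (\<Union>(l, r)\<in>R. (\<lambda>u. (sharp l, sharp u)) ` {u. supteq r u})"
    unfolding DP_def by auto
  ultimately show ?thesis by (rule finite_subset[rotated])
qed

lemma wf_tree_root: "wf_tree F R T \<Longrightarrow> fst (tree_root T) \<subseteq> DP R \<and> snd (tree_root T) = R"
  by (cases T) (auto simp: dp_problem_def)

definition dh_bounded :: "('f \<times> nat) set \<Rightarrow> 'f rule set \<Rightarrow> ('f trm \<Rightarrow> nat) \<Rightarrow> 'f proof_tree \<Rightarrow> bool" where
  "dh_bounded F R B T \<longleftrightarrow> (\<forall>P geq gr P' Q t. ((P, R), Reduction_Pair geq gr P', (Q, R)) \<in> edges T \<longrightarrow>
     t \<in> terms F \<longrightarrow> dh (sharp t) (rel_rstep (P - Q) (plain_rules R \<union> Q)) \<le> enat (B t))"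

text \<open>The children of a dependency graph node need ranks of equal length although their
  subtrees differ in height. Ranks are therefore built for all sufficiently large \<open>d\<close>,
  which serves finitely many children at once.\<close>

lemma rank_exists:
  assumes trs: "trs F R" and fin: "finite R"
    and B: "\<And>t. card (DP R) \<le> B t" "\<And>t. arg_sum R t \<le> B t"
    and "wf_tree F R T" "dh_bounded F R B T"
  shows "\<forall>\<^sub>F d in sequentially. \<exists>rk. rank F R B (dpstep (fst (tree_root T))) d rk"
  using assms(5,6)
proof (induction T)
  case (Leaf p)
  then have "rank F R B (dpstep (fst (tree_root (Leaf p)))) d (\<lambda>t. replicate d 0)" for d
    using rank_zeros[of F R B d] by (simp add: dpstep_empty)
  then show ?case by (intro always_eventually) blast
next
  case (Inner p \<Phi> ts)
  obtain P where p: "p = (P, R)" and PD: "P \<subseteq> DP R"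
    using Inner.prems(1) by (cases p) (auto simp: dp_problem_def)
  have sub: "apply_processor F \<Phi> p \<subseteq> tree_root ` set ts" using Inner.prems(1) by simp
  have IH: "\<forall>\<^sub>F d in sequentially. \<exists>rk. rank F R B (dpstep (fst (tree_root c))) d rk"
    if c: "c \<in> set ts" for c
  proof (rule Inner.IH[OF c])
    show "wf_tree F R c" using Inner.prems(1) c by simp
    have "edges c \<subseteq> edges (Inner p \<Phi> ts)" using c by auto
    then show "dh_bounded F R B c" using Inner.prems(2) unfolding dh_bounded_def by blast
  qed
  have child: "Q \<subseteq> DP R \<and> (\<forall>\<^sub>F d in sequentially. \<exists>rk. rank F R B (dpstep Q) d rk) \<and>
      ((P, R), \<Phi>, (Q, R)) \<in> edges (Inner p \<Phi> ts)"
    if Q: "(Q, R) \<in> apply_processor F \<Phi> p" for Q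
  proof -
    obtain c where c: "c \<in> set ts" "tree_root c = (Q, R)" using sub Q by force
    moreover have "wf_tree F R c" using Inner.prems(1) c(1) by simp
    ultimately show ?thesis using IH[OF c(1)] wf_tree_root[of F R c] p by force
  qed
  have "\<forall>\<^sub>F d in sequentially. \<exists>rk. rank F R B (dpstep P) (Suc d) rk"
    if Q: "(Q, R) \<in> apply_processor F \<Phi> p" and dec: "\<And>d rk. rank F R B (dpstep Q) d rk \<Longrightarrow>
      \<exists>rk. rank F R B (dpstep P) (Suc d) rk" for Q
    using child[OF Q] dec by (auto elim!: eventually_mono)
  note reduce = this
  \<comment> \<open>A subterm criterion that fails returns its own problem; a leading zero then
    accounts for the increase of \<open>d\<close>.\<close>
  have copy: "\<exists>rk. rank F R B (dpstep P) (Suc d) rk" if "rank F R B (dpstep P) d rk" for d rk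
  proof -
    have "rank F R B (dpstep P) (Suc d) (\<lambda>t. 0 # rk t)"
      by (rule rank_Cons_two[OF that, of _ "{}"]) auto
    then show ?thesis by blast
  qed
  have "\<forall>\<^sub>F d in sequentially. \<exists>rk. rank F R B (dpstep P) (Suc d) rk"
  proof (cases \<Phi>)
    case (Reduction_Pair geq gr P')
    then have "(P', R) \<in> apply_processor F \<Phi> p \<or> (P, R) \<in> apply_processor F \<Phi> p"
      unfolding p by simp
    then obtain Q where Q: "(Q, R) \<in> apply_processor F \<Phi> p" by blast
    have dh: "dh (sharp t) (rel_rstep (P - Q) (plain_rules R \<union> Q)) \<le> enat (B t)"
      if "t \<in> terms F" for t
      using child[OF Q] Inner.prems(2) that unfolding dh_bounded_def Reduction_Pair by blast
    show ?thesis
      by (rule reduce[OF Q]) (rule rank_reduction_pair[OF trs PD _ _ dh], use child[OF Q] in auto)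
  next
    case Dependency_Graph
    have "\<forall>\<^sub>F d in sequentially. \<forall>c\<in>set ts. \<exists>rk. rank F R B (dpstep (fst (tree_root c))) d rk"
      by (rule eventually_ball_finite) (use IH in auto)
    then show ?thesis
    proof (rule eventually_mono)
      fix d assume *: "\<forall>c\<in>set ts. \<exists>rk. rank F R B (dpstep (fst (tree_root c))) d rk"
      show "\<exists>rk. rank F R B (dpstep P) (Suc d) rk"
      proof (rule rank_dependency_graph[OF trs PD])
        show "finite P" using finite_subset[OF PD finite_DP[OF fin]] .
        show "card P \<le> B t" for t using card_mono[OF finite_DP[OF fin] PD] B(1) le_trans by blast
        fix C assume "C \<in> sccs P (dg_edges F P R)" "\<not> trivial_scc (dg_edges F P R) C"
        then have "(C, R) \<in> apply_processor F \<Phi> p" using Dependency_Graph p by simp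
        then obtain c where "c \<in> set ts" "tree_root c = (C, R)" using sub by force
        then show "\<exists>rk. rank F R B (dpstep C) d rk" using * by force
      qed
    qed
  next
    case (Subterm_Criterion \<pi> P')
    show ?thesis
    proof (cases "simple_projection \<pi> (P \<union> P') \<and>
        (\<forall>(s, t)\<in>P'. supteq (proj \<pi> s) (proj \<pi> t)) \<and> (\<forall>(s, t)\<in>P - P'. supt (proj \<pi> s) (proj \<pi> t))")
      case True
      have "apply_processor F \<Phi> p = {(P', R)}"
        unfolding Subterm_Criterion p apply_processor.simps by (rule if_P[OF True])
      then have "(P', R) \<in> apply_processor F \<Phi> p" by simp
      then show ?thesis
        by (rule reduce) (use True in \<open>intro rank_subterm_criterion[OF _ _ _ _ B(2)], auto\<close>)
    next
      case False
      have "apply_processor F \<Phi> p = {(P, R)}"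
        unfolding Subterm_Criterion p apply_processor.simps by (rule if_not_P[OF False])
      then have "(P, R) \<in> apply_processor F \<Phi> p" by simp
      from reduce[OF this copy] show ?thesis .
    qed
  qed
  then show ?case
    using p eventually_sequentially_Suc[of "\<lambda>d. \<exists>rk. rank F R B (dpstep P) d rk"] by simp
qed

subsection \<open>The upper bound\<close>

definition args_bounded :: "'f rule set \<Rightarrow> nat \<Rightarrow> 'f trm \<Rightarrow> bool" where
  "args_bounded R n t \<longleftrightarrow> (\<exists>f ts. t = Fun f ts \<and> (\<forall>s\<in>set ts. bounded_by R n s))"

lemma args_bounded_sn: "t \<in> terms F \<Longrightarrow> args_bounded R n t \<Longrightarrow> args_sn F R t"
  unfolding args_bounded_def args_sn_def by (blast intro: snI)

lemma bounded_by_step_weak: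
  assumes "bounded_by R n t" "(t, u) \<in> rstep R"
  shows "bounded_by R n u"
proof (cases n)
  case 0
  then show ?thesis using assms(1) not_bounded_by_0 by blast
next
  case (Suc k)
  then have "bounded_by R k u" using bounded_by_step assms by blast
  then show ?thesis by (rule bounded_by_mono) (simp add: Suc)
qed

lemma args_bounded_argstep:
  assumes "args_bounded R n s" "(s, t) \<in> argstep R"
  shows "args_bounded R n t"
proof -
  obtain f ss u v us where *: "s = Fun f (ss @ u # us)" "t = Fun f (ss @ v # us)" "(u, v) \<in> rstep R"
    using assms(2) unfolding argstep_def by blast
  have "bounded_by R n u" using assms(1) * by (auto simp: args_bounded_def)
  then have "bounded_by R n v" using bounded_by_step_weak *(3) by blast
  then show ?thesis using assms(1) * unfolding args_bounded_def by auto
qed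

lemma argsteps_root:
  assumes "(Fun f ts, t) \<in> (argstep R)\<^sup>*"
  shows "\<exists>us. t = Fun f us \<and> length us = length ts"
  using assms
proof (induction rule: rtrancl_induct)
  case (step t u)
  then show ?case by (auto simp: argstep_def)
qed simp

lemma sum_list_le_mult: "(\<And>x. x \<in> set xs \<Longrightarrow> f x \<le> n) \<Longrightarrow> sum_list (map f xs) \<le> length xs * (n::nat)"
  by (induction xs) (auto intro: add_mono)

lemma funpow_le:
  assumes "\<And>y. y \<le> h y" "m \<le> n"
  shows "(h ^^ m) y \<le> (h ^^ n) (y::nat)"
  using assms(2) by (rule lift_Suc_mono_le[of "\<lambda>n. (h ^^ n) y", rotated]) (simp add: assms(1))

lemma funpow_ge:
  assumes "\<And>y. y \<le> h y"
  shows "y \<le> (h ^^ n) (y::nat)"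
  using funpow_le[of h 0 n y] assms by simp

lemma sum_least_bound_le:
  assumes "\<And>s. s \<in> set ts \<Longrightarrow> bounded_by R n s"
  shows "(\<Sum>s\<leftarrow>ts. least_bound R s) \<le> length ts * n"
  by (rule sum_list_le_mult) (rule least_bound_le[OF assms])

text \<open>Subterms of a right-hand side are bounded from the inside out, with one application of
  \<open>h\<close> per symbol. Variables and proper subterms of \<open>l\<close> inherit the bound
  of the arguments, a root that is not defined admits no root step, and what remains is an instance
  of a dependency pair.\<close>

lemma rhs_bounded:
  fixes h :: "nat \<Rightarrow> nat"
  assumes trs: "trs F R" and lr: "(l, r) \<in> R"
    and l: "subst l \<sigma> \<in> terms F" "args_bounded R M (subst l \<sigma>)"
    and arity: "\<And>f n. (f, n) \<in> F \<Longrightarrow> n \<le> q"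
    and h: "\<And>y. y \<le> h y" "\<And>y. M \<le> y \<Longrightarrow> Suc (q * y) \<le> h y"
    and dp: "\<And>u y. M \<le> y \<Longrightarrow> (sharp l, sharp u) \<in> DP R \<Longrightarrow> subst u \<sigma> \<in> terms F \<Longrightarrow>
      args_bounded R y (subst u \<sigma>) \<Longrightarrow> bounded_by R (h y) (subst u \<sigma>)"
  shows "supteq r u \<Longrightarrow> bounded_by R ((h ^^ tsize u) M) (subst u \<sigma>)"
proof -
  have r: "r \<in> terms F" "vars r \<subseteq> vars l" and "\<forall>x. l \<noteq> Var x"
    using trs lr by (auto simp: trs_def)
  then obtain f ls where lF: "l = Fun f ls" by (cases l) auto
  have arg: "bounded_by R M (subst w \<sigma>)" if "v \<in> set ls" "supteq v w" for v w
  proof (rule bounded_by_supteq[OF _ supteq_subst[OF that(2)]])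
    show "bounded_by R M (subst v \<sigma>)" using l(2) that(1) unfolding args_bounded_def lF by auto
  qed
  note ge = funpow_ge[OF h(1)]
  have \<sigma>: "\<sigma> x \<in> terms F" if "x \<in> vars l" for x
    using supteq_terms[OF supteq_subst_var[OF that] l(1)] .
  show "supteq r u \<Longrightarrow> bounded_by R ((h ^^ tsize u) M) (subst u \<sigma>)"
  proof (induction u)
    case (Var x)
    then have "x \<in> vars l" using supteq_vars[OF Var] r(2) by auto
    then obtain v where v: "v \<in> set ls" "x \<in> vars v" unfolding lF by auto
    have "bounded_by R M (subst v \<sigma>)" using arg[OF v(1) supteq_refl] .
    then have "bounded_by R M (\<sigma> x)" by (rule bounded_by_supteq[OF _ supteq_subst_var[OF v(2)]])
    then have "bounded_by R (h M) (\<sigma> x)" by (rule bounded_by_mono) (rule h(1))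
    then show ?case by simp
  next
    case (Fun g us)
    let ?n = "\<Sum>t\<leftarrow>us. tsize t" let ?y = "(h ^^ ?n) M"
    let ?us = "map (\<lambda>t. subst t \<sigma>) us"
    have us: "bounded_by R ?y s" if s: "s \<in> set ?us" for s
    proof -
      obtain v where v: "v \<in> set us" "s = subst v \<sigma>" using s by auto
      have "supteq (Fun g us) v" unfolding supteq_Fun using v(1) supteq_refl by blast
      then have "bounded_by R ((h ^^ tsize v) M) s"
        using Fun.IH[OF v(1)] supteq_trans[OF Fun.prems] v(2) by simp
      moreover have "tsize v \<le> ?n" using v(1) member_le_sum_list[of "tsize v" "map tsize us"] by simp
      then have "(h ^^ tsize v) M \<le> ?y" by (rule funpow_le[OF h(1)])
      ultimately show ?thesis by (rule bounded_by_mono)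
    qed
    have u: "Fun g us \<in> terms F" using supteq_terms[OF Fun.prems r(1)] .
    have u\<sigma>: "subst (Fun g us) \<sigma> \<in> terms F"
      by (rule subst_terms[OF u]) (use \<sigma> r(2) supteq_vars[OF Fun.prems] in blast)
    have "bounded_by R (h ?y) (subst (Fun g us) \<sigma>)"
    proof (cases "(g, length us) \<in> defined_syms R")
      case False
      \<comment> \<open>No term has the bound 0; the choice \<open>X = 0\<close> is sound because no
        rule ever applies at a root that is not defined.\<close>
      have "bounded_by R (Suc (0 + (\<Sum>s\<leftarrow>?us. least_bound R s))) (Fun g ?us)"
      proof (rule bounded_by_Fun)
        show "\<forall>s\<in>set ?us. sn R s" using us by (blast intro: snI)
        fix t' l' r' \<tau> assume *: "(Fun g ?us, t') \<in> (argstep R)\<^sup>*" "(l', r') \<in> R" "t' = subst l' \<tau>"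
        obtain us' where us': "t' = Fun g us'" "length us' = length us"
          using argsteps_root[OF *(1)] by auto
        have "\<forall>x. l' \<noteq> Var x" using trs *(2) by (auto simp: trs_def)
        then obtain ls' where "l' = Fun g ls'" "length ls' = length us"
          using us' *(3) by (cases l') auto
        then have "(g, length us) \<in> defined_syms R" using *(2) unfolding defined_syms_def
          by (intro CollectI exI[of _ g] exI[of _ ls'] exI[of _ r']) simp
        then show "bounded_by R 0 (subst r' \<tau>)" using False by simp
      qed
      moreover have "(\<Sum>s\<leftarrow>?us. least_bound R s) \<le> length us * ?y"
        using sum_least_bound_le[of ?us R ?y] us by simp
      moreover have "length us * ?y \<le> q * ?y"
        using arity[of g "length us"] u by (intro mult_le_mono1) (simp add: Fun_in_terms)
      ultimately have "Suc (0 + (\<Sum>s\<leftarrow>?us. least_bound R s)) \<le> h ?y"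
        using h(2)[OF ge[of M ?n]] by linarith
      with \<open>bounded_by R _ (Fun g ?us)\<close> show ?thesis unfolding subst.simps by (rule bounded_by_mono)
    next
      case True
      show ?thesis
      proof (cases "supt l (Fun g us)")
        case True
        then obtain v where "v \<in> set ls" "supteq v (Fun g us)" unfolding lF supt_Fun by blast
        then have "bounded_by R M (subst (Fun g us) \<sigma>)" by (rule arg)
        then show ?thesis by (rule bounded_by_mono) (rule le_trans[OF ge h(1)])
      next
        case False
        then have DP: "(sharp l, sharp (Fun g us)) \<in> DP R"
          unfolding sharp_DP_iff using lr Fun.prems True by blast
        show ?thesis
          by (rule dp[OF ge DP u\<sigma>]) (use us in \<open>auto simp: args_bounded_def\<close>)
      qed
    qed
    then show ?case by simp
  qed
qed

lemma lexbelow_append: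
  assumes "(b, a) \<in> lex less_than" "\<And>v. v \<in> set b \<union> set e \<Longrightarrow> v < y" "length e = length e'"
  shows "lexbelow y (b @ e) (a @ e')"
proof -
  obtain c x bs x' as where "b = c @ x # bs" "a = c @ x' # as" "x < x'" "length bs = length as"
    using assms(1) by (auto simp: lex_conv)
  then show ?thesis using lexbelowI[of x x' "bs @ e" "as @ e'" y c] assms(2,3) by auto
qed

lemma lexle_zeros: "lexle (replicate (length a) 0) a"
  unfolding lexle_def by (induction a) auto

lemma lexle_trans: "lexle a b \<Longrightarrow> lexle b c \<Longrightarrow> lexle a c"
  unfolding lexle_def using lex_transI[OF trans_less_than] by (auto dest: transD)

lemma lex_lexle_trans: "(a, b) \<in> lex less_than \<Longrightarrow> lexle b c \<Longrightarrow> (a, c) \<in> lex less_than"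
  unfolding lexle_def using lex_transI[OF trans_less_than] by (auto dest: transD)

text \<open>Pad \<open>e\<close> with zeros to the length of \<open>a @ e\<close>; passing from
  these zeros to \<open>a\<close> is a lexicographic increase with small entries behind it.\<close>

lemma ackl_append_mono:
  assumes "e \<noteq> []" "\<And>v. v \<in> set e \<Longrightarrow> v < y"
  shows "ackl e y \<le> ackl (a @ e) y"
proof -
  have y: "y > 0" using assms(2)[of "hd e"] assms(1) by simp
  have "ackl e y = ackl (replicate (length a) 0 @ e) y" using ackl_pad[OF assms(1)] by simp
  also have "\<dots> \<le> ackl (a @ e) y"
  proof (cases "replicate (length a) 0 = a")
    case False
    then have "(replicate (length a) 0, a) \<in> lex less_than"
      using lexle_zeros[of a] unfolding lexle_def by simp
    then have "lexbelow y (replicate (length a) 0 @ e) (a @ e)"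
      by (rule lexbelow_append) (use assms(2) y in \<open>auto split: if_splits\<close>)
    then show ?thesis using ackl_basic[of "a @ e"] assms(1) by simp
  qed simp
  finally show ?thesis .
qed

text \<open>The rank of a term, padded by a fixed tuple \<open>c @ [j]\<close>, indexes the Ackermann function that
  bounds it: the ranks of the dependency pair successors are lexicographically smaller and have
  entries below \<open>ackl (c @ [j])\<close>, and incrementing \<open>j\<close> pays for the fixed number of nested calls in
  a right-hand side.\<close>

lemma bounded_by_rank:
  assumes trs: "trs F R" and rk: "rank F R B (dpstep (DP R)) d rk"
    and arity: "\<And>f n. (f, n) \<in> F \<Longrightarrow> n \<le> q"
    and size: "\<And>l r. (l, r) \<in> R \<Longrightarrow> tsize r \<le> k"
    and B: "\<And>t y. t \<in> terms F \<Longrightarrow> args_bounded R y t \<Longrightarrow> B t < ackl (c @ [j]) y"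
    and lin: "\<And>y. Suc (q * y + 2 * y) \<le> ackl (c @ [j]) y"
    and M: "\<And>v. v \<in> set c \<Longrightarrow> v < M" "Suc (j + Suc (2 * k)) < M"
    and t: "t \<in> terms F" "args_bounded R M t"
  shows "bounded_by R (ackl (rk t @ c @ [Suc (j + Suc (2 * k))]) M) t"
  using M t
proof (induction t arbitrary: M rule: wf_induct_rule[OF wf_inv_image[OF wf_lex[OF wf_less_than], of rk]])
  case (1 t)
  note M = 1(2,3) and t = 1(4,5)
  let ?e = "c @ [Suc (j + Suc (2 * k))]" and ?A = "ackl (rk t @ c @ [j])"
  have IH: "bounded_by R (ackl (rk u @ ?e) y) u"
    if "(rk u, rk t) \<in> lex less_than" "M \<le> y" "u \<in> terms F" "args_bounded R y u" for u y
  proof (rule 1(1)[OF _ _ _ that(3,4)])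
    show "(u, t) \<in> inv_image (lex less_than) rk" using that(1) by (simp add: in_inv_image)
    show "v < y" if "v \<in> set c" for v using M(1)[OF that] \<open>M \<le> y\<close> by simp
    show "Suc (j + Suc (2 * k)) < y" using M(2) that(2) by simp
  qed
  have A: "y \<le> ?A y" for y using ackl_gt[of "rk t @ c @ [j]" y] by simp
  have low: "ackl (c @ [j]) y \<le> ?A y" if y: "M \<le> y" for y
  proof (rule ackl_append_mono)
    fix v assume "v \<in> set (c @ [j])"
    then have "v < M" using M(1)[of v] M(2) by auto
    then show "v < y" using y by simp
  qed simp
  \<comment> \<open>A call at bound \<open>y\<close> costs two applications of \<open>?A\<close>:
    one lifts the argument above all entries of the smaller rank, the other pays for the comparison
    of the indices there.\<close>
  define h where "h = (\<lambda>y. ?A (?A y))"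
  have h: "y \<le> h y" for y unfolding h_def by (rule le_trans[OF A A])
  obtain f ts where tF: "t = Fun f ts" and ts: "\<And>s. s \<in> set ts \<Longrightarrow> bounded_by R M s"
    using t(2) unfolding args_bounded_def by blast
  let ?X = "(h ^^ k) M"
  have "bounded_by R (Suc (?X + (\<Sum>s\<leftarrow>ts. least_bound R s))) (Fun f ts)"
  proof (rule bounded_by_Fun)
    show "\<forall>s\<in>set ts. sn R s" using ts by (blast intro: snI)
    fix t' l r \<sigma> assume *: "(Fun f ts, t') \<in> (argstep R)\<^sup>*" "(l, r) \<in> R" "t' = subst l \<sigma>"
    have "(t, t') \<in> (argstep R)\<^sup>*" using *(1) tF by simp
    then have "t' \<in> terms F \<and> args_bounded R M t' \<and> lexle (rk t') (rk t)"
    proof (induction rule: rtrancl_induct)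
      case base
      then show ?case using t by (simp add: lexle_def)
    next
      case (step u v)
      then have "args_sn F R u" using args_bounded_sn by blast
      then have "lexle (rk v) (rk u)" using rk step.hyps(2) unfolding rank_def by blast
      then have "lexle (rk v) (rk t)" using step.IH lexle_trans by blast
      moreover have "v \<in> terms F"
        using rstep_terms[OF trs subsetD[OF argstep_rstep step.hyps(2)]] step.IH by blast
      ultimately show ?case using args_bounded_argstep[OF _ step.hyps(2)] step.IH by blast
    qed
    then have t': "subst l \<sigma> \<in> terms F" "args_bounded R M (subst l \<sigma>)" "lexle (rk (subst l \<sigma>)) (rk t)"
      using *(3) by simp_all
    have "bounded_by R ((h ^^ tsize r) M) (subst r \<sigma>)"
    proof (rule rhs_bounded[OF trs *(2) t'(1,2) arity h _ _ supteq_refl])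
      show "Suc (q * y) \<le> h y" if "M \<le> y" for y
        unfolding h_def using lin[of y] low[OF that] A[of "?A y"] by linarith
    next
      fix u y assume u: "M \<le> y" "(sharp l, sharp u) \<in> DP R" "subst u \<sigma> \<in> terms F"
        "args_bounded R y (subst u \<sigma>)"
      let ?u = "subst u \<sigma>" and ?z = "ackl (c @ [j]) y"
      note sn = args_bounded_sn[OF u(3,4)]
      have "(subst l \<sigma>, ?u) \<in> dpstep (DP R)" using u(2) unfolding dpstep_def by blast
      then have "(rk ?u, rk (subst l \<sigma>)) \<in> lex less_than"
        using rk args_bounded_sn[OF t'(1,2)] sn unfolding rank_def by blast
      then have lt: "(rk ?u, rk t) \<in> lex less_than" using t'(3) by (rule lex_lexle_trans)
      have z: "y < ?z" by (rule ackl_gt) simp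
      have "v < ?z" if "v \<in> set (rk ?u)" for v
      proof -
        have "v \<le> B ?u" using rk sn that unfolding rank_def by blast
        then show ?thesis using B[OF u(3,4)] by simp
      qed
      moreover have "v < ?z" if "v \<in> set ?e" for v
      proof -
        have "v < M" using that M(1)[of v] M(2) by auto
        then show ?thesis using u(1) z by simp
      qed
      \<comment> \<open>The padding on the left is the larger one. This does no harm because the
        descent happens inside the rank and the padding lies below \<open>?z\<close>.\<close>
      ultimately have "lexbelow ?z (rk ?u @ ?e) (rk t @ c @ [j])"
        by (intro lexbelow_append[OF lt]) auto
      then have "ackl (rk ?u @ ?e) ?z \<le> ?A ?z" using ackl_basic[of "rk t @ c @ [j]"] by simp
      moreover have "ackl (rk ?u @ ?e) y \<le> ackl (rk ?u @ ?e) ?z"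
        using z by (intro ackl_mono) auto
      moreover have "?A ?z \<le> ?A (?A y)" using low[OF u(1)] by (intro ackl_mono) auto
      ultimately have "ackl (rk ?u @ ?e) y \<le> h y" unfolding h_def by linarith
      with IH[OF lt u(1,3,4)] show "bounded_by R (h y) ?u" by (rule bounded_by_mono)
    qed
    then show "bounded_by R ?X (subst r \<sigma>)"
      by (rule bounded_by_mono) (rule funpow_le[OF h size[OF *(2)]])
  qed
  then have "bounded_by R (Suc (?X + (\<Sum>s\<leftarrow>ts. least_bound R s))) t" unfolding tF .
  then show ?case
  proof (rule bounded_by_mono)
    have MX: "M \<le> ?X" by (rule funpow_ge[OF h])
    have "(\<Sum>s\<leftarrow>ts. least_bound R s) \<le> length ts * M" by (rule sum_least_bound_le[OF ts])
    also have "\<dots> \<le> q * M" using arity[of f "length ts"] t(1) tF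
      by (intro mult_le_mono1) (simp add: Fun_in_terms)
    also have "\<dots> \<le> q * ?X" using MX by simp
    finally have "Suc (?X + (\<Sum>s\<leftarrow>ts. least_bound R s)) \<le> Suc (q * ?X + 2 * ?X)" by simp
    also have "\<dots> \<le> ackl (c @ [j]) ?X" by (rule lin)
    also have "\<dots> \<le> ?A ?X" by (rule low[OF MX])
    \<comment> \<open>Up to \<open>k\<close> nested uses of \<open>h\<close> give
      \<open>2 * k\<close> applications of \<open>?A\<close>, and one more absorbs the sum over the
      arguments; this is the origin of \<open>Suc (2 * k)\<close>.\<close>
    also have "\<dots> = (?A ^^ Suc (2 * k)) M"
    proof -
      have "?X = (?A ^^ (2 * k)) M" unfolding h_def by (induction k) auto
      then show ?thesis by simp
    qed
    also have "\<dots> \<le> ackl ((rk t @ c) @ [Suc j + Suc (2 * k)]) M"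
      using ackl_funpow[where c = "rk t @ c" and j = j and n = "Suc (2 * k)" and y = M]
      by (simp only: append_assoc)
    finally show "Suc (?X + (\<Sum>s\<leftarrow>ts. least_bound R s)) \<le> ackl (rk t @ ?e) M" by simp
  qed
qed

text \<open>If the arguments of \<open>t\<close> are bounded by \<open>y\<close>, then
  \<open>t\<close> has size at most \<open>Suc (q * y)\<close>, because bounds include sizes. So
  \<open>g\<close> at the size of \<open>t\<close> is below a branch in \<open>y\<close>
  alone.\<close>

lemma rank_bound_dominated:
  assumes "mono g" "dominated g"
  obtains c j where
    "\<And>t y. t \<in> terms F \<Longrightarrow> (\<And>f n. (f, n) \<in> F \<Longrightarrow> n \<le> q) \<Longrightarrow> args_bounded R y t \<Longrightarrow>
      g (tsize t) + p + arg_sum R t < ackl (c @ [j]) y"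
    "\<And>y. Suc (q * y + 2 * y) \<le> ackl (c @ [j]) y"
proof -
  have id: "dominated (\<lambda>y. n * y)" for n by (rule dominated_mult[OF dominated_id])
  have S: "dominated (\<lambda>y. Suc (h y))" if "dominated h" for h by (rule dominated_comp[OF dominated_Suc that])
  have "dominated (\<lambda>y. g (Suc (q * y)))" by (rule dominated_comp[OF assms(2) S[OF id]])
  then have "dominated (\<lambda>y. Suc (g (Suc (q * y)) + p + q * y))"
    by (rule S[OF dominated_add[OF dominated_add[OF _ dominated_const] id]])
  moreover have "dominated (\<lambda>y. Suc (q * y + 2 * y))" by (rule S[OF dominated_add[OF id id]])
  ultimately obtain c j where 1: "\<And>y. Suc (g (Suc (q * y)) + p + q * y) \<le> ackl (c @ [j]) y"
    and 2: "\<And>y. Suc (q * y + 2 * y) \<le> ackl (c @ [j]) y"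
    by (rule dominated_common2) blast
  show ?thesis
  proof (rule that[OF _ 2])
    fix t y assume t: "t \<in> terms F" and q: "\<And>f n. (f, n) \<in> F \<Longrightarrow> n \<le> q" and b: "args_bounded R y t"
    obtain f ts where tF: "t = Fun f ts" and ts: "\<And>s. s \<in> set ts \<Longrightarrow> bounded_by R y s"
      using b unfolding args_bounded_def by blast
    have len: "length ts * y \<le> q * y" using q[of f "length ts"] t tF
      by (intro mult_le_mono1) (simp add: Fun_in_terms)
    have "arg_sum R t \<le> length ts * y" using sum_least_bound_le[OF ts] tF by (simp add: arg_sum_def)
    moreover have "(\<Sum>s\<leftarrow>ts. tsize s) \<le> length ts * y"
      by (rule sum_list_le_mult) (rule bounded_by_tsize[OF ts])
    then have "g (tsize t) \<le> g (Suc (q * y))" using tF le_trans[OF _ len] by (intro monoD[OF assms(1)]) simp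
    ultimately show "g (tsize t) + p + arg_sum R t < ackl (c @ [j]) y" using 1[of y] len by linarith
  qed
qed

lemma Var_normal_form: "trs F R \<Longrightarrow> (Var x, u) \<notin> rstep R"
proof
  assume "trs F R" "(Var x, u) \<in> rstep R"
  from this(2) obtain l r \<sigma> where "(l, r) \<in> R" "Var x = subst l \<sigma>"
    by (cases rule: rstep.cases) auto
  then show False using \<open>trs F R\<close> by (cases l) (auto simp: trs_def)
qed

text \<open>\<open>D\<close> is iterated once per symbol, from the inside out. Starting at the
  threshold \<open>N\<close> guarantees that \<open>step\<close> is applicable at every
  level.\<close>

lemma bounded_by_funpow:
  fixes D :: "nat \<Rightarrow> nat"
  assumes trs: "trs F R" and D: "\<And>y. y \<le> D y" and N: "0 < N"
    and step: "\<And>M t. N \<le> M \<Longrightarrow> t \<in> terms F \<Longrightarrow> args_bounded R M t \<Longrightarrow> bounded_by R (D M) t"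
  shows "t \<in> terms F \<Longrightarrow> bounded_by R ((D ^^ tsize t) N) t"
proof (induction t)
  case (Var x)
  have "bounded_by R (Suc 0) (Var x)"
    by (rule bounded_by_SucI) (use Var_normal_form[OF trs] in auto)
  then show ?case by (rule bounded_by_mono) (use D[of N] N in simp)
next
  case (Fun f ts)
  let ?M = "(D ^^ (\<Sum>t\<leftarrow>ts. tsize t)) N"
  have "bounded_by R ?M s" if s: "s \<in> set ts" for s
  proof -
    have "bounded_by R ((D ^^ tsize s) N) s"
      by (rule Fun.IH) (use s Fun.prems in \<open>auto simp: Fun_in_terms\<close>)
    moreover have "tsize s \<le> (\<Sum>t\<leftarrow>ts. tsize t)"
      using s member_le_sum_list[of "tsize s" "map tsize ts"] by simp
    then have "(D ^^ tsize s) N \<le> ?M" by (rule funpow_le[OF D])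
    ultimately show ?thesis by (rule bounded_by_mono)
  qed
  then have "args_bounded R ?M (Fun f ts)" unfolding args_bounded_def by blast
  then have "bounded_by R (D ?M) (Fun f ts)" by (rule step[OF funpow_ge[OF D] Fun.prems])
  then show ?case by simp
qed

lemma dc_multiply_recursive:
  assumes sig: "signature F" and trs: "trs F R" and fin: "finite R" and T: "proof_tree F R T"
    and g: "reduction_pair_function F R T g" "multiply_recursive_unary g"
  shows "\<exists>h. multiply_recursive_unary h \<and> (\<forall>n. dc F R n \<le> enat (h n))"
proof -
  define q where "q = Max (insert 0 (snd ` F))"
  have q: "n \<le> q" if "(f, n) \<in> F" for f n
    unfolding q_def using that sig by (intro Max_ge) (auto simp: signature_def intro: rev_image_eqI)
  define k where "k = Max (insert 0 ((tsize \<circ> snd) ` R))"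
  have k: "tsize r \<le> k" if "(l, r) \<in> R" for l r
    unfolding k_def using that fin by (intro Max_ge) (auto intro: rev_image_eqI)
  have mono: "mono g" using g(1) unfolding reduction_pair_function_def by blast
  define B where "B = (\<lambda>t. g (tsize t) + card (DP R) + arg_sum R t)"
  have dh: "dh_bounded F R B T"
    unfolding dh_bounded_def
  proof (intro allI impI)
    fix P geq gr P' Q t assume *: "((P, R), Reduction_Pair geq gr P', (Q, R)) \<in> edges T" "t \<in> terms F"
    have "dh (sharp t) (rel_rstep (P - Q) (plain_rules R \<union> Q)) \<le> enat (g (tsize t))"
      using g(1) * unfolding reduction_pair_function_def by blast
    also have "\<dots> \<le> enat (B t)" by (simp add: B_def)
    finally show "dh (sharp t) (rel_rstep (P - Q) (plain_rules R \<union> Q)) \<le> enat (B t)" .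
  qed
  have tree: "wf_tree F R T" "fst (tree_root T) = DP R" using T by (auto simp: proof_tree_def)
  have "\<forall>\<^sub>F d in sequentially. \<exists>rk. rank F R B (dpstep (fst (tree_root T))) d rk"
    by (rule rank_exists[OF trs fin _ _ tree(1) dh]) (auto simp: B_def)
  then have "\<exists>d rk. rank F R B (dpstep (DP R)) d rk"
    unfolding tree(2) eventually_sequentially by blast
  then obtain d rk where rk: "rank F R B (dpstep (DP R)) d rk" by blast
  obtain c j where Bt: "\<And>t y. t \<in> terms F \<Longrightarrow> args_bounded R y t \<Longrightarrow> B t < ackl (c @ [j]) y"
    and lin: "\<And>y. Suc (q * y + 2 * y) \<le> ackl (c @ [j]) y"
    unfolding B_def
    by (rule rank_bound_dominated[OF mono multiply_recursive_unary_dominated[OF g(2)], of F q R "card (DP R)"])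
      (use q in blast)
  let ?e = "c @ [Suc (j + Suc (2 * k))]"
  define N where "N = Suc (Max (set ?e))"
  have N: "v < M" if "v \<in> set ?e" "N \<le> M" for v M
    using Max_ge[OF finite_set that(1)] that(2) unfolding N_def by linarith
  \<comment> \<open>This removes the dependence of the index on the rank of \<open>t\<close>: at
    \<open>?z\<close> the argument exceeds all entries of rank and padding, so one unit index of
    fixed length serves every term.\<close>
  have step: "bounded_by R (ackl (1 # replicate (d + length ?e) 0) (ackl (c @ [j]) M)) t"
    if "N \<le> M" "t \<in> terms F" "args_bounded R M t" for M t
  proof -
    let ?z = "ackl (c @ [j]) M"
    have z: "M < ?z" by (rule ackl_gt) simp
    have "bounded_by R (ackl (rk t @ ?e) M) t"
      by (rule bounded_by_rank[OF trs rk q k Bt lin _ _ that(2,3)]) (use N that(1) in auto)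
    moreover have "ackl (rk t @ ?e) M \<le> ackl (rk t @ ?e) ?z"
      using z by (intro ackl_mono) auto
    moreover have "ackl (rk t @ ?e) ?z \<le> ackl (1 # replicate (d + length ?e) 0) ?z"
    proof (rule ackl_less_unit)
      show "length (rk t @ ?e) \<le> d + length ?e" using rk unfolding rank_def by simp
      fix v assume "v \<in> set (rk t @ ?e)"
      then consider "v \<in> set (rk t)" | "v \<in> set ?e" by auto
      then show "v < ?z"
      proof cases
        case 1
        have "v \<le> B t" using rk args_bounded_sn[OF that(2,3)] 1 unfolding rank_def by blast
        then show ?thesis using Bt[OF that(2,3)] by simp
      next
        case 2
        then show ?thesis using N[OF _ that(1)] z by fastforce
      qed
    qed simp
    ultimately have "ackl (rk t @ ?e) M \<le> ackl (1 # replicate (d + length ?e) 0) ?z" by linarith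
    with \<open>bounded_by R (ackl (rk t @ ?e) M) t\<close> show ?thesis by (rule bounded_by_mono)
  qed
  have "dominated (\<lambda>M. ackl (1 # replicate (d + length ?e) 0) (ackl (c @ [j]) M))"
    by (rule dominated_comp[OF dominatedI[OF _ order_refl] dominatedI[OF _ order_refl]]) auto
  then obtain c' j' where le: "\<And>M. ackl (1 # replicate (d + length ?e) 0) (ackl (c @ [j]) M) \<le> ackl (c' @ [j']) M"
    by (rule dominatedE) blast
  let ?D = "ackl (c' @ [j'])"
  have D: "y \<le> ?D y" for y using ackl_gt[of "c' @ [j']" y] by simp
  have bd: "bounded_by R ((?D ^^ tsize t) N) t" if "t \<in> terms F" for t
    by (rule bounded_by_funpow[OF trs D _ _ that])
      (simp add: N_def, rule bounded_by_mono[OF step le])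
  \<comment> \<open>Size at most \<open>n\<close> means at most \<open>n\<close> iterations from the
    constant \<open>N\<close>, which the next branch bounds as a function of
    \<open>n\<close>.\<close>
  have "dc F R n \<le> enat (ackl (c' @ [Suc j' + N]) n)" for n
    unfolding dc_def
  proof (rule SUP_least)
    fix t assume "t \<in> {t \<in> terms F. tsize t \<le> n}"
    then have t: "t \<in> terms F" "tsize t \<le> n" by auto
    have "(?D ^^ tsize t) N \<le> (?D ^^ n) N" by (rule funpow_le[OF D t(2)])
    also have "\<dots> \<le> ackl (c' @ [Suc j']) (N + n)" by (rule ackl_funpow_arg)
    also have "\<dots> \<le> ackl (c' @ [Suc j' + N]) n" using ackl_add[of c' "Suc j'" n N] by (simp add: add.commute)
    finally have "bounded_by R (ackl (c' @ [Suc j' + N]) n) t"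
      by (rule bounded_by_mono[OF bd[OF t(1)]])
    then show "dh t (rstep R) \<le> enat (ackl (c' @ [Suc j' + N]) n)" by (rule bounded_by_dh)
  qed
  moreover have "multiply_recursive_unary (ackl (c' @ [Suc j' + N]))"
    by (rule multiply_recursive_unary_ackl) simp
  ultimately show ?thesis by blast
qed

subsection \<open>Tightness\<close>

abbreviation zero_trm :: "nat trm" where "zero_trm \<equiv> Fun 0 []"
abbreviation suc_trm :: "nat trm \<Rightarrow> nat trm" where "suc_trm t \<equiv> Fun 1 [t]"
abbreviation ack_trm :: "nat trm list \<Rightarrow> nat trm" where "ack_trm ts \<equiv> Fun 2 ts"

primrec num :: "nat \<Rightarrow> nat trm" where
  "num 0 = zero_trm"
| "num (Suc n) = suc_trm (num n)"

text \<open>The arity is \<open>n + 2\<close>: \<open>n + 1\<close> index places and the last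
  argument. In the reset rules, \<open>i\<close> counts the places before the decremented one and
  \<open>j\<close> the zeros that are kept, whence \<open>Suc (i + j) = n\<close>.\<close>

definition ack_trs :: "nat \<Rightarrow> nat rule set" where
  "ack_trs n =
    {(ack_trm (replicate (Suc n) zero_trm @ [Var 0]), suc_trm (Var 0)),
     (ack_trm (map Var [0..<n] @ [suc_trm (Var n), zero_trm]),
      ack_trm (map Var [0..<n] @ [Var n, suc_trm zero_trm])),
     (ack_trm (map Var [0..<n] @ [suc_trm (Var n), suc_trm (Var (Suc n))]),
      ack_trm (map Var [0..<n] @ [Var n,
        ack_trm (map Var [0..<n] @ [suc_trm (Var n), Var (Suc n)])]))} \<union>
    {(ack_trm (map Var [0..<i] @ suc_trm (Var i) # replicate (Suc j) zero_trm @ [Var (Suc i)]),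
      ack_trm (map Var [0..<i] @ Var i # Var (Suc i) # replicate j zero_trm @ [Var (Suc i)])) | i j.
      Suc (i + j) = n}"

text \<open>Symbol 3 counts down the value computed by the Ackermann function, so that derivations become at
  least as long as this value is large. Symbol 4 applied to the numeral of \<open>n\<close> starts a derivation
  for the argument \<open>n + 2\<close> from a term of that size; the constant 5 does so for the argument 1.\<close>

definition witness_trs :: "nat list \<Rightarrow> nat rule set" where
  "witness_trs a = ack_trs (length a - 1) \<union>
    {(Fun 3 [suc_trm (Var 0)], Fun 3 [Var 0]),
     (Fun 4 [Var 0], Fun 3 [ack_trm (map num a @ [suc_trm (suc_trm (Var 0))])]),
     (Fun 5 [], Fun 3 [ack_trm (map num a @ [suc_trm zero_trm])])}"

definition witness_sig :: "nat list \<Rightarrow> (nat \<times> nat) set" where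
  "witness_sig a = {(0, 0), (1, 1), (2, Suc (length a)), (3, 1), (4, 1), (5, 0)}"

lemma subst_num [simp]: "subst (num n) \<sigma> = num n"
  by (induction n) auto

lemma tsize_num [simp]: "tsize (num n) = Suc n"
  by (induction n) auto

lemma vars_num [simp]: "vars (num n) = {}"
  by (induction n) auto

lemma num_terms: "num n \<in> terms (witness_sig a)"
  by (induction n) (auto simp: Fun_in_terms witness_sig_def)

lemma subst_Vars: "n \<le> length ts \<Longrightarrow> map (\<lambda>t. subst t (\<lambda>i. ts ! i)) (map Var [0..<n]) = take n ts"
  by (rule nth_equalityI) auto

lemma rsteps_arg:
  "(s, t) \<in> (rstep R)\<^sup>* \<Longrightarrow> (Fun f (ss @ s # us), Fun f (ss @ t # us)) \<in> (rstep R)\<^sup>*"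
proof (induction rule: rtrancl_induct)
  case (step t u)
  then show ?case using rstep.arg[OF step.hyps(2)] rtrancl.rtrancl_into_rtrancl by metis
qed simp

text \<open>Each equation of \<open>ack\<close> is one root step whose substitution looks up the
  numerals by variable number; the nested equation in addition evaluates its inner call below the
  root.\<close>

lemma ack_trs_simulation:
  assumes "ack_trs n \<subseteq> R"
  shows "length xs = Suc (Suc n) \<Longrightarrow> (ack_trm (map num xs), num (ack xs)) \<in> (rstep R)\<^sup>*"
proof (induction xs rule: ack.induct)
  case (1 k y)
  then have "k = n" by simp
  then have "(ack_trm (replicate (Suc k) zero_trm @ [Var 0]), suc_trm (Var 0)) \<in> R"
    using assms by (auto simp: ack_trs_def)
  from rstep.root[OF this, of "\<lambda>_. num y"] show ?case
    unfolding ack.simps(1) by (simp add: r_into_rtrancl)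
next
  case (2 xs x)
  then have n: "length xs = n" by simp
  then have "(ack_trm (map Var [0..<n] @ [suc_trm (Var n), zero_trm]),
    ack_trm (map Var [0..<n] @ [Var n, suc_trm zero_trm])) \<in> R"
    using assms by (auto simp: ack_trs_def)
  from rstep.root[OF this, of "\<lambda>i. map num (xs @ [x]) ! i"]
  have "(ack_trm (map num (xs @ [Suc x, 0])), ack_trm (map num (xs @ [x, 1]))) \<in> rstep R"
    using subst_Vars[of n "map num (xs @ [x])"] n by (simp add: nth_append)
  moreover have "(ack_trm (map num (xs @ [x, 1])), num (ack (xs @ [x, 1]))) \<in> (rstep R)\<^sup>*"
    by (rule 2) (use n in simp)
  ultimately show ?case unfolding ack.simps(2) by (rule converse_rtrancl_into_rtrancl)
next
  case (3 xs x y)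
  then have n: "length xs = n" by simp
  then have "(ack_trm (map Var [0..<n] @ [suc_trm (Var n), suc_trm (Var (Suc n))]),
      ack_trm (map Var [0..<n] @ [Var n,
        ack_trm (map Var [0..<n] @ [suc_trm (Var n), Var (Suc n)])])) \<in> R"
    using assms by (auto simp: ack_trs_def)
  from rstep.root[OF this, of "\<lambda>i. map num (xs @ [x, y]) ! i"]
  have "(ack_trm (map num (xs @ [Suc x, Suc y])),
    ack_trm ((map num xs @ [num x]) @ ack_trm (map num (xs @ [Suc x, y])) # [])) \<in> rstep R"
    using subst_Vars[of n "map num (xs @ [x, y])"] n by (simp add: nth_append)
  also have "(ack_trm (map num (xs @ [Suc x, y])), num (ack (xs @ [Suc x, y]))) \<in> (rstep R)\<^sup>*"
    by (rule 3) (use n in simp)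
  note rsteps_arg[OF this, of 2 "map num xs @ [num x]" "[]"]
  also have "ack_trm ((map num xs @ [num x]) @ num (ack (xs @ [Suc x, y])) # []) =
    ack_trm (map num (xs @ [x, ack (xs @ [Suc x, y])]))" by simp
  also have "(ack_trm (map num (xs @ [x, ack (xs @ [Suc x, y])])),
    num (ack (xs @ [x, ack (xs @ [Suc x, y])]))) \<in> (rstep R)\<^sup>*"
    by (rule 3) (use n in simp)
  finally show ?case unfolding ack.simps(3) .
next
  case (4 xs x j y)
  let ?i = "length xs"
  have n: "Suc (?i + j) = n" using 4 by simp
  then have "(ack_trm (map Var [0..<?i] @ suc_trm (Var ?i) # replicate (Suc j) zero_trm @ [Var (Suc ?i)]),
      ack_trm (map Var [0..<?i] @ Var ?i # Var (Suc ?i) # replicate j zero_trm @ [Var (Suc ?i)])) \<in> R"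
    using assms unfolding ack_trs_def by blast
  from rstep.root[OF this, of "\<lambda>i. map num (xs @ [x, y]) ! i"]
  have "(ack_trm (map num (xs @ Suc x # replicate (Suc j) 0 @ [y])),
    ack_trm (map num (xs @ x # y # replicate j 0 @ [y]))) \<in> rstep R"
    using subst_Vars[of ?i "map num (xs @ [x, y])"] by (simp add: nth_append)
  moreover have "(ack_trm (map num (xs @ x # y # replicate j 0 @ [y])),
      num (ack (xs @ x # y # replicate j 0 @ [y]))) \<in> (rstep R)\<^sup>*"
    by (rule 4) (use n in simp)
  ultimately show ?case unfolding ack.simps(4) by (rule converse_rtrancl_into_rtrancl)
next
  case (5 xs)
  then show ?case by simp
qed

lemma countdown:
  assumes "(Fun 3 [suc_trm (Var 0)], Fun 3 [Var 0]) \<in> R"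
  shows "(Fun 3 [num m], Fun 3 [zero_trm]) \<in> rstep R ^^ m"
proof (induction m)
  case (Suc m)
  have "(Fun 3 [num (Suc m)], Fun 3 [num m]) \<in> rstep R"
    using rstep.root[OF assms, of "\<lambda>_. num m"] by simp
  then show ?case using Suc by (rule relpow_Suc_I2)
qed simp

lemma dh_ge:
  assumes "(s, t) \<in> r\<^sup>*" "(t, u) \<in> r ^^ m"
  shows "enat m \<le> dh s r"
proof -
  obtain k where "(s, t) \<in> r ^^ k" using assms(1) rtrancl_imp_relpow by blast
  then have "(s, u) \<in> r ^^ (k + m)" using assms(2) unfolding relpow_add by blast
  then have "enat (k + m) \<le> dh s r" unfolding dh_def by (intro SUP_upper) blast
  then show ?thesis by (rule order_trans[rotated]) simp
qed

lemma dc_witness_trs: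
  assumes "a \<noteq> []" "n \<noteq> 0"
  shows "enat (ackl a n) \<le> dc (witness_sig a) (witness_trs a) n"
proof -
  let ?R = "witness_trs a" and ?F = "witness_sig a"
  obtain t where t: "t \<in> terms ?F" "tsize t \<le> n"
    "(t, Fun 3 [ack_trm (map num (a @ [n]))]) \<in> rstep ?R"
  proof (cases "n = 1")
    case True
    have "(Fun 5 [], Fun 3 [ack_trm (map num a @ [suc_trm zero_trm])]) \<in> ?R"
      by (simp add: witness_trs_def)
    from rstep.root[OF this, of Var]
    have "(Fun 5 [], Fun 3 [ack_trm (map num (a @ [n]))]) \<in> rstep ?R"
      using True by (simp add: comp_def)
    then show ?thesis by (rule that[rotated 2]) (use True in \<open>auto simp: Fun_in_terms witness_sig_def\<close>)
  next
    case False
    then obtain m where m: "n = Suc (Suc m)" using assms(2) by (metis One_nat_def not0_implies_Suc)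
    have "(Fun 4 [Var 0], Fun 3 [ack_trm (map num a @ [suc_trm (suc_trm (Var 0))])]) \<in> ?R"
      by (simp add: witness_trs_def)
    from rstep.root[OF this, of "\<lambda>_. num m"]
    have "(Fun 4 [num m], Fun 3 [ack_trm (map num (a @ [n]))]) \<in> rstep ?R"
      using m by (simp add: comp_def)
    then show ?thesis
      by (rule that[rotated 2]) (use m num_terms[of m a] in \<open>auto simp: Fun_in_terms witness_sig_def\<close>)
  qed
  have "(ack_trm (map num (a @ [n])), num (ack (a @ [n]))) \<in> (rstep ?R)\<^sup>*"
    by (rule ack_trs_simulation[of "length a - 1"]) (use assms(1) in \<open>auto simp: witness_trs_def\<close>)
  from rsteps_arg[OF this, of 3 "[]" "[]"]
  have "(t, Fun 3 [num (ackl a n)]) \<in> (rstep ?R)\<^sup>*"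
    using converse_rtrancl_into_rtrancl[OF t(3)] by (simp add: ackl_def)
  moreover have "(Fun 3 [num (ackl a n)], Fun 3 [zero_trm]) \<in> rstep ?R ^^ ackl a n"
    by (rule countdown) (simp add: witness_trs_def)
  ultimately have "enat (ackl a n) \<le> dh t (rstep ?R)" by (rule dh_ge)
  also have "\<dots> \<le> dc ?F ?R n" unfolding dc_def by (rule SUP_upper) (use t in blast)
  finally show ?thesis .
qed

section \<open>Proof trees for the witness systems\<close>

definition lex_decreasing :: "nat \<Rightarrow> 'f dprule \<Rightarrow> bool" where
  "lex_decreasing i p \<longleftrightarrow> (\<exists>f ls us j. p = (Fun (Sharp f) ls, Fun (Sharp f) us) \<and>
     length ls = length us \<and> i \<le> j \<and> j < length ls \<and> (\<forall>m<j. ls ! m = us ! m) \<and>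
     supt (ls ! j) (us ! j))"

text \<open>Without reduction pair edges, a reduction pair function only has to reach the maximal
  number of components, so a constant function qualifies.\<close>

definition rp_free :: "'f proof_tree \<Rightarrow> bool" where
  "rp_free T \<longleftrightarrow> (\<forall>p geq gr P' q. (p, Reduction_Pair geq gr P', q) \<notin> edges T)"

text \<open>Step \<open>i\<close> projects every symbol to its argument number \<open>i + 1\<close> and thereby removes the pairs
  whose first decrease is in that argument.\<close>

lemma lex_decreasing_proof_tree:
  assumes "P \<subseteq> DP R" "\<And>p. p \<in> P \<Longrightarrow> lex_decreasing i p"
    "\<And>f ls t. (Fun f ls, t) \<in> P \<Longrightarrow> length ls \<le> n"
  shows "\<exists>T. wf_tree F R T \<and> tree_root T = (P, R) \<and> rp_free T"
  using assms
proof (induction "n - i" arbitrary: i P)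
  case 0
  have "p \<notin> P" for p
  proof
    assume p: "p \<in> P"
    then obtain f ls us j where "p = (Fun (Sharp f) ls, Fun (Sharp f) us)" "i \<le> j" "j < length ls"
      using "0.prems"(2) unfolding lex_decreasing_def by blast
    then have "length ls \<le> n" using "0.prems"(3) p by blast
    then show False using \<open>0 = n - i\<close> \<open>i \<le> j\<close> \<open>j < length ls\<close> by simp
  qed
  then have "P = {}" by blast
  then show ?case by (intro exI[of _ "Leaf ({}, R)"]) (simp add: rp_free_def)
next
  case (Suc d)
  \<comment> \<open>Pairs whose first decrease is further to the right. Both sides agree at position
    \<open>i\<close>, counted from 0, so the projection is weakly decreasing on them.\<close>
  define P' where "P' = {p \<in> P. lex_decreasing (Suc i) p}"
  have "\<exists>T. wf_tree F R T \<and> tree_root T = (P', R) \<and> rp_free T"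
  proof (rule Suc.hyps(1))
    show "d = n - Suc i" using Suc.hyps(2) by simp
    show "P' \<subseteq> DP R" using Suc.prems(1) unfolding P'_def by blast
    show "lex_decreasing (Suc i) p" if "p \<in> P'" for p using that unfolding P'_def by simp
    show "length ls \<le> n" if "(Fun f ls, t) \<in> P'" for f ls t
      using that Suc.prems(3) unfolding P'_def by blast
  qed
  then obtain T where T: "wf_tree F R T" "tree_root T = (P', R)" "rp_free T" by blast
  let ?\<pi> = "\<lambda>_. Suc i" and ?\<Phi> = "Subterm_Criterion (\<lambda>_. Suc i) P'"
  have dec: "\<exists>f ls us. (s, t) = (Fun (Sharp f) ls, Fun (Sharp f) us) \<and> i < length ls \<and> length ls = length us \<and>
      supteq (ls ! i) (us ! i) \<and> ((s, t) \<notin> P' \<longrightarrow> supt (ls ! i) (us ! i))"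
    if st: "(s, t) \<in> P" for s t
  proof -
    obtain f ls us j where *: "(s, t) = (Fun (Sharp f) ls, Fun (Sharp f) us)" "length ls = length us"
      "i \<le> j" "j < length ls" "\<forall>m<j. ls ! m = us ! m" "supt (ls ! j) (us ! j)"
      using Suc.prems(2)[OF st] unfolding lex_decreasing_def by blast
    show ?thesis
    proof (cases "i = j")
      case True
      then show ?thesis using * by (auto simp: supt_def)
    next
      case False
      then have "lex_decreasing (Suc i) (s, t)" using * unfolding lex_decreasing_def
        by (intro exI[of _ f] exI[of _ ls] exI[of _ us] exI[of _ j]) simp
      then have "(s, t) \<in> P'" using st unfolding P'_def by simp
      then show ?thesis using * False by auto
    qed
  qed
  have "P \<union> P' = P" unfolding P'_def by blast
  have cond: "simple_projection ?\<pi> (P \<union> P') \<and>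
      (\<forall>(s, t)\<in>P'. supteq (proj ?\<pi> s) (proj ?\<pi> t)) \<and> (\<forall>(s, t)\<in>P - P'. supt (proj ?\<pi> s) (proj ?\<pi> t))"
  proof (intro conjI)
    show "simple_projection ?\<pi> (P \<union> P')"
      unfolding \<open>P \<union> P' = P\<close> simple_projection_def using dec by fastforce
    show "\<forall>(s, t)\<in>P'. supteq (proj ?\<pi> s) (proj ?\<pi> t)"
      using dec unfolding P'_def by fastforce
    show "\<forall>(s, t)\<in>P - P'. supt (proj ?\<pi> s) (proj ?\<pi> t)"
      using dec by fastforce
  qed
  have "apply_processor F ?\<Phi> (P, R) = {(P', R)}"
    unfolding apply_processor.simps by (rule if_P[OF cond])
  then have "wf_tree F R (Inner (P, R) ?\<Phi> [T])"
    using T Suc.prems(1) by (simp add: dp_problem_def)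
  then show ?case using T(3) by (intro exI[of _ "Inner (P, R) ?\<Phi> [T]"]) (simp add: rp_free_def)
qed

lemma ack_trs_cases:
  assumes "(l, r) \<in> ack_trs n"
  obtains (zeros) "l = ack_trm (replicate (Suc n) zero_trm @ [Var 0])" "r = suc_trm (Var 0)"
  | (zero) "l = ack_trm (map Var [0..<n] @ [suc_trm (Var n), zero_trm])"
      "r = ack_trm (map Var [0..<n] @ [Var n, suc_trm zero_trm])"
  | (suc) "l = ack_trm (map Var [0..<n] @ [suc_trm (Var n), suc_trm (Var (Suc n))])"
      "r = ack_trm (map Var [0..<n] @ [Var n,
        ack_trm (map Var [0..<n] @ [suc_trm (Var n), Var (Suc n)])])"
  | (reset) i j where "Suc (i + j) = n"
      "l = ack_trm (map Var [0..<i] @ suc_trm (Var i) # replicate (Suc j) zero_trm @ [Var (Suc i)])"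
      "r = ack_trm (map Var [0..<i] @ Var i # Var (Suc i) # replicate j zero_trm @ [Var (Suc i)])"
  using assms unfolding ack_trs_def by blast

lemma witness_trs_cases:
  assumes "(l, r) \<in> witness_trs a"
  obtains (ack) "(l, r) \<in> ack_trs (length a - 1)"
  | (count) "l = Fun 3 [suc_trm (Var 0)]" "r = Fun 3 [Var 0]"
  | (start) "l = Fun 4 [Var 0]" "r = Fun 3 [ack_trm (map num a @ [suc_trm (suc_trm (Var 0))])]"
  | (start_1) "l = Fun 5 []" "r = Fun 3 [ack_trm (map num a @ [suc_trm zero_trm])]"
  using assms unfolding witness_trs_def by blast

lemma trs_witness_trs:
  assumes "a \<noteq> []"
  shows "trs (witness_sig a) (witness_trs a)"
  unfolding trs_def
proof clarify
  fix l r assume "(l, r) \<in> witness_trs a"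
  then show "l \<in> terms (witness_sig a) \<and> r \<in> terms (witness_sig a) \<and> (\<forall>x. l \<noteq> Var x) \<and> vars r \<subseteq> vars l"
  proof (cases rule: witness_trs_cases)
    case ack
    have len: "Suc (length a - 1) = length a" using assms by simp
    have sig: "(0, 0) \<in> witness_sig a" "(Suc 0, Suc 0) \<in> witness_sig a" "(2, Suc (length a)) \<in> witness_sig a"
      unfolding witness_sig_def by auto
    from ack show ?thesis
      by (cases rule: ack_trs_cases) (use len sig in \<open>auto simp: Fun_in_terms\<close>)
  qed (use num_terms[of _ a] in \<open>auto simp: Fun_in_terms witness_sig_def\<close>)
qed

lemma finite_witness_trs: "finite (witness_trs a)"
proof -
  have fin: "finite {h i j | i j. Suc (i + j) = n}" for h :: "nat \<Rightarrow> nat \<Rightarrow> nat rule" and n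
  proof (rule finite_subset)
    show "{h i j | i j. Suc (i + j) = n} \<subseteq> (\<lambda>(i, j). h i j) ` ({..n} \<times> {..n})" by fastforce
  qed simp
  have "finite (ack_trs n)" for n
    unfolding ack_trs_def by (rule finite_UnI[OF _ fin]) simp
  then show ?thesis unfolding witness_trs_def by simp
qed

lemma witness_defined_syms: "(f, n) \<in> defined_syms (witness_trs a) \<Longrightarrow> f \<notin> {0, 1}"
proof -
  assume "(f, n) \<in> defined_syms (witness_trs a)"
  then obtain ts r where "(Fun f ts, r) \<in> witness_trs a" unfolding defined_syms_def by blast
  then show ?thesis
    by (cases rule: witness_trs_cases) (auto elim: ack_trs_cases)
qed

lemma lex_decreasingI:
  assumes "supt p q" "length bs = length cs"
  shows "lex_decreasing 0 (sharp (Fun f (as @ p # bs)), sharp (Fun f (as @ q # cs)))"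
  unfolding lex_decreasing_def
proof (intro exI conjI)
  show "supt ((map plain (as @ p # bs)) ! length as) ((map plain (as @ q # cs)) ! length as)"
    using assms(1) by (simp add: supt_plain nth_append)
qed (use assms(2) in \<open>auto simp: nth_append\<close>)

lemma supteq_Var: "supteq (Var x) t \<longleftrightarrow> t = Var x"
  by (simp add: supteq_def)

lemma supteq_num: "supteq (num n) t \<Longrightarrow> \<exists>m. t = num m"
proof (induction n)
  case 0
  then have "t = num 0" by (simp add: supteq_def)
  then show ?case by blast
next
  case (Suc n)
  then have "t = num (Suc n) \<or> supteq (num n) t" by (auto simp: supteq_Fun)
  then show ?case using Suc.IH by blast
qed

lemma supt_suc: "supt (suc_trm t) t"
  by (simp add: supt_Fun)

text \<open>The inner call of the nested equation decreases in the last argument; every other call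
  decreases at an index place, whatever happens to the right of it.\<close>

lemma ack_trs_DP:
  assumes "(l, r) \<in> ack_trs n" "supteq r (Fun f ts)" "f \<notin> {0, 1}"
  shows "f = 2 \<and> lex_decreasing 0 (sharp l, sharp (Fun f ts))"
  using assms(1)
proof (cases rule: ack_trs_cases)
  case zeros
  then show ?thesis using assms(2,3) by (auto simp: supteq_Fun supteq_Var)
next
  case zero
  then have "Fun f ts = r" using assms(2,3) by (auto simp: supteq_Fun supteq_Var)
  then show ?thesis
    using lex_decreasingI[OF supt_suc, of "[zero_trm]" "[suc_trm zero_trm]" 2 "map Var [0..<n]" "Var n"] zero
    by auto
next
  case suc
  let ?u = "ack_trm (map Var [0..<n] @ [suc_trm (Var n), Var (Suc n)])"
  have "Fun f ts = r \<or> Fun f ts = ?u"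
    using assms(2,3) suc by (auto simp: supteq_Fun supteq_Var)
  then show ?thesis
  proof
    assume *: "Fun f ts = r"
    then show ?thesis
      using lex_decreasingI[OF supt_suc, of "[suc_trm (Var (Suc n))]" "[?u]" 2 "map Var [0..<n]" "Var n"] suc
      by auto
  next
    assume *: "Fun f ts = ?u"
    then show ?thesis
      using lex_decreasingI[OF supt_suc, of "[]" "[]" 2 "map Var [0..<n] @ [suc_trm (Var n)]" "Var (Suc n)"] suc
      by auto
  qed
next
  case (reset i j)
  have *: "Fun f ts = r" using assms(2,3) reset by (auto simp: supteq_Fun supteq_Var)
  then show ?thesis
    using lex_decreasingI[OF supt_suc, of "replicate (Suc j) zero_trm @ [Var (Suc i)]"
        "Var (Suc i) # replicate j zero_trm @ [Var (Suc i)]" 2 "map Var [0..<i]" "Var i"] reset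
    by auto
qed

lemma start_subterms:
  assumes "supteq (Fun 3 [ack_trm (map num a @ [t])]) (Fun f ts)" "f \<notin> {0, 1}"
    "\<And>u. supteq t u \<Longrightarrow> (\<exists>x. u = Var x) \<or> (\<exists>us. u = Fun 0 us) \<or> (\<exists>us. u = Fun 1 us)"
  shows "f \<in> {2, 3}"
proof -
  have "\<not> supteq t (Fun f ts)" using assms(3)[of "Fun f ts"] assms(2) by auto
  moreover have "\<not> supteq (num m) (Fun f ts)" for m
  proof
    assume "supteq (num m) (Fun f ts)"
    then obtain m' where "Fun f ts = num m'" using supteq_num by blast
    then show False using assms(2) by (cases m') auto
  qed
  ultimately show ?thesis using assms(1) by (auto simp: supteq_Fun)
qed

text \<open>Calls lead to the symbols 2 and 3 only, whereas the pairs that may fail to decrease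
  start from 4 or 5; this mismatch cuts them off in the dependency graph.\<close>

lemma witness_DP:
  assumes "p \<in> DP (witness_trs a)" "a \<noteq> []"
  obtains f ls h us where "p = (Fun (Sharp f) ls, Fun (Sharp h) us)" "h \<in> {2, 3}"
    "f \<in> {4, 5} \<or> lex_decreasing 0 p" "length ls \<le> Suc (length a)"
proof -
  obtain l u where p: "p = (sharp l, sharp u)" using assms(1) by (rule DP_sharp)
  have "(sharp l, sharp u) \<in> DP (witness_trs a)" using p assms(1) by simp
  then obtain r h us where r: "(l, r) \<in> witness_trs a" "supteq r u" "u = Fun h us"
    "(h, length us) \<in> defined_syms (witness_trs a)"
    unfolding sharp_DP_iff by blast
  have h: "h \<notin> {0, 1}" using witness_defined_syms r(4) by blast
  have "l \<in> terms (witness_sig a)" "\<forall>x. l \<noteq> Var x"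
    using trs_witness_trs[OF assms(2)] r(1) unfolding trs_def by auto
  then obtain f ls where l: "l = Fun f ls" "(f, length ls) \<in> witness_sig a"
    by (cases l) (auto simp: Fun_in_terms)
  have "length ls \<le> Suc (length a)" using l(2) by (auto simp: witness_sig_def)
  moreover have "h \<in> {2, 3} \<and> (f \<in> {4, 5} \<or> lex_decreasing 0 p)"
    using r(1)
  proof (cases rule: witness_trs_cases)
    case ack
    from ack_trs_DP[OF ack r(2)[unfolded r(3)] h] show ?thesis using p r(3) by auto
  next
    case count
    then have "u = Fun 3 [Var 0]" using r(2) r(3) by (auto simp: supteq_Fun supteq_Var)
    then show ?thesis using count p r(3) lex_decreasingI[OF supt_suc, of "[]" "[]" 3 "[]" "Var 0"] by simp
  next
    case start
    have "h \<in> {2, 3}"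
      by (rule start_subterms[OF r(2)[unfolded start r(3)] h]) (auto simp: supteq_Fun supteq_Var)
    then show ?thesis using start l by auto
  next
    case start_1
    have "h \<in> {2, 3}"
      by (rule start_subterms[OF r(2)[unfolded start_1 r(3)] h]) (auto simp: supteq_Fun supteq_Var)
    then show ?thesis using start_1 l by auto
  qed
  ultimately show ?thesis using that p l(1) r(3) by auto
qed

text \<open>Left-hand sides of the plain rules are unmarked and not variables, so none of them
  matches at a marked root.\<close>

lemma sharp_root_rstep:
  assumes "trs F R" "(Fun (Sharp f) ts, t) \<in> (rstep (plain_rules R))\<^sup>*"
  shows "\<exists>us. t = Fun (Sharp f) us"
  using assms(2)
proof (induction rule: rtrancl_induct)
  case (step t u)
  from step.IH obtain us where t: "t = Fun (Sharp f) us" by blast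
  from step.hyps(2) show ?case
  proof (cases rule: rstep.cases)
    case (root l r \<sigma>)
    then obtain l' r' where "(l', r') \<in> R" "l = plain l'" by (auto simp: plain_rules_def)
    moreover from this have "\<forall>x. l' \<noteq> Var x" using assms(1) by (auto simp: trs_def)
    ultimately show ?thesis using root t by (cases l') auto
  next
    case (arg s t' f' ss us')
    then show ?thesis using t by auto
  qed
qed blast

text \<open>The start pairs are out of reach for the subterm criterion: symbol 5 has no argument to
  project to, and in a pair from 4 no argument on the right is a subterm of the variable on the
  left. Having no incoming edge, they belong to no nontrivial component.\<close>

lemma witness_scc:
  fixes a defines "E \<equiv> dg_edges (witness_sig a) (DP (witness_trs a)) (witness_trs a)"
  assumes a: "a \<noteq> []" and C: "C \<in> sccs (DP (witness_trs a)) E" "\<not> trivial_scc E C" and p: "p \<in> C"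
  shows "lex_decreasing 0 p"
proof (rule ccontr)
  assume nlex: "\<not> lex_decreasing 0 p"
  have CP: "C \<subseteq> DP (witness_trs a)" using C(1) unfolding sccs_def by blast
  obtain f ls t where pf: "p = (Fun (Sharp f) ls, t)" "f \<in> {4, 5}"
    by (rule witness_DP[OF subsetD[OF CP p] a]) (use nlex in blast)
  have no_edge: "(q, p) \<notin> E" for q
  proof
    assume "(q, p) \<in> E"
    then obtain s t' \<sigma> \<tau> where q: "(s, t') \<in> DP (witness_trs a)"
      and st: "(subst t' \<sigma>, subst (Fun (Sharp f) ls) \<tau>) \<in> (rstep (plain_rules (witness_trs a)))\<^sup>*"
      unfolding E_def dg_edges_def pf(1) by blast
    obtain h us where "t' = Fun (Sharp h) us" "h \<in> {2, 3}"
      by (rule witness_DP[OF q a]) auto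
    then show False using sharp_root_rstep[OF trs_witness_trs[OF a], of h] st pf(2) by fastforce
  qed
  have "q = p" if "q \<in> C" for q
  proof -
    have "(q, p) \<in> E\<^sup>*" using C(1) p that unfolding sccs_def connected_nodes_def by blast
    then show ?thesis by (rule rtranclE) (use no_edge in auto)
  qed
  then have "C = {p}" using p by blast
  moreover have "(p, p) \<notin> E\<^sup>+"
  proof
    assume "(p, p) \<in> E\<^sup>+"
    then show False by (rule tranclE) (use no_edge in auto)
  qed
  ultimately show False using C(2) unfolding trivial_scc_def by blast
qed

lemma witness_proof_tree:
  assumes a: "a \<noteq> []"
  shows "\<exists>T. proof_tree (witness_sig a) (witness_trs a) T \<and> rp_free T"
proof -
  let ?F = "witness_sig a" and ?R = "witness_trs a" let ?P = "DP ?R" let ?E = "dg_edges ?F ?P ?R"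
  let ?S = "{C \<in> sccs ?P ?E. \<not> trivial_scc ?E C}"
  have "finite ?S"
    by (rule finite_subset[of _ "Pow ?P"]) (use finite_DP[OF finite_witness_trs] in \<open>auto simp: sccs_def\<close>)
  then obtain Cs where Cs: "set Cs = ?S" using finite_list by blast
  have "\<forall>C\<in>?S. \<exists>T. wf_tree ?F ?R T \<and> tree_root T = (C, ?R) \<and> rp_free T"
  proof
    fix C assume C: "C \<in> ?S"
    then have CP: "C \<subseteq> ?P" unfolding sccs_def by blast
    show "\<exists>T. wf_tree ?F ?R T \<and> tree_root T = (C, ?R) \<and> rp_free T"
    proof (rule lex_decreasing_proof_tree[OF CP])
      show "lex_decreasing 0 p" if "p \<in> C" for p using witness_scc[OF a _ _ that] C by blast
      show "length ls \<le> Suc (length a)" if "(Fun f ls, t) \<in> C" for f ls t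
        by (rule witness_DP[OF subsetD[OF CP that] a]) simp
    qed
  qed
  from bchoice[OF this] obtain tr where
    tr: "\<And>C. C \<in> ?S \<Longrightarrow> wf_tree ?F ?R (tr C) \<and> tree_root (tr C) = (C, ?R) \<and> rp_free (tr C)" by blast
  \<comment> \<open>The leaf keeps the list of children nonempty, whatever the components
    are.\<close>
  let ?T = "Inner (?P, ?R) Dependency_Graph (Leaf ({}, ?R) # map tr Cs)"
  have "apply_processor ?F Dependency_Graph (?P, ?R) \<subseteq> tree_root ` set (Leaf ({}, ?R) # map tr Cs)"
  proof
    fix x assume "x \<in> apply_processor ?F Dependency_Graph (?P, ?R)"
    then obtain C where C: "x = (C, ?R)" "C \<in> ?S" by auto
    then have "x = tree_root (tr C)" "C \<in> set Cs" using tr[OF C(2)] Cs by auto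
    then show "x \<in> tree_root ` set (Leaf ({}, ?R) # map tr Cs)" by auto
  qed
  then have "proof_tree ?F ?R ?T"
    using tr Cs unfolding proof_tree_def by (auto simp: dp_problem_def)
  moreover have "rp_free ?T" using tr Cs unfolding rp_free_def by auto
  ultimately show ?thesis by blast
qed

lemma multiply_recursive_majorised:
  assumes "1 \<le> m" "multiply_recursive m f"
  shows "\<exists>(F :: (nat \<times> nat) set) R T g.
    signature F \<and> trs F R \<and> finite R \<and> proof_tree F R T \<and>
    reduction_pair_function F R T g \<and> multiply_recursive_unary g \<and> majorises (dc F R) m f"
proof -
  obtain c j where f: "\<And>xs y. length xs = m \<Longrightarrow> (\<And>x. x \<in> set xs \<Longrightarrow> x \<le> y) \<Longrightarrow> f xs \<le> ackl (c @ [j]) y"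
    using list_dominatedE[OF multiply_recursive_dominated[OF assms(2)]] by blast
  let ?a = "c @ [j]" let ?F = "witness_sig ?a" and ?R = "witness_trs ?a"
  obtain T where T: "proof_tree ?F ?R T" "rp_free T" using witness_proof_tree[of ?a] by blast
  have "signature ?F" by (auto simp: signature_def witness_sig_def)
  moreover have "reduction_pair_function ?F ?R T (\<lambda>_. max_sccs ?F T)"
    using T(2) unfolding reduction_pair_function_def rp_free_def by (auto intro: monoI)
  moreover have "majorises (dc ?F ?R) m f"
    unfolding majorises_def
  proof (intro allI impI)
    fix xs :: "nat list" assume xs: "length xs = m" "Max (set xs) \<noteq> 0"
    have "f xs \<le> ackl ?a (Max (set xs))" by (rule f[OF xs(1)]) simp
    then have "enat (f xs) \<le> enat (ackl ?a (Max (set xs)))" by simp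
    also have "\<dots> \<le> dc ?F ?R (Max (set xs))" by (rule dc_witness_trs) (use xs in auto)
    finally show "enat (f xs) \<le> dc ?F ?R (Max (set xs))" .
  qed
  ultimately show ?thesis
    using T(1) trs_witness_trs[of ?a] finite_witness_trs[of ?a]
      multiply_recursive_unary_const[of "max_sccs ?F T"] by blast
qed

theorem theorem2:
  shows "(\<forall>(F :: ('f \<times> nat) set) R T g.
            signature F \<longrightarrow> trs F R \<longrightarrow> finite R \<longrightarrow> proof_tree F R T \<longrightarrow>
            reduction_pair_function F R T g \<longrightarrow> multiply_recursive_unary g \<longrightarrow>
            (\<exists>h. multiply_recursive_unary h \<and> (\<forall>n. dc F R n \<le> enat (h n)))) \<and>
         (\<forall>m f. 1 \<le> m \<longrightarrow> multiply_recursive m f \<longrightarrow>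
            (\<exists>(F :: (nat \<times> nat) set) R T g.
               signature F \<and> trs F R \<and> finite R \<and> proof_tree F R T \<and>
               reduction_pair_function F R T g \<and> multiply_recursive_unary g \<and>
               majorises (dc F R) m f))"
  by (intro conjI allI impI dc_multiply_recursive multiply_recursive_majorised)

end
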